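(* Let $m,n\ge 1$ be integers with $m+n\ge 3$, let $\Theta\in\mathbb{R}^{n\times m}$, $\boldsymbol\eta\in\mathbb{R}^n$, and let $\boldsymbol\sigma=(\sigma_1,\ldots,\sigma_m)$, $\boldsymbol\rho=(\rho_1,\ldots,\rho_n)$ be weights: $\sigma_1\ge\ldots\ge\sigma_m>0$, $\rho_1\ge\ldots\ge\rho_n>0$, $\sum_{j=1}^m\sigma_j=\sum_{i=1}^n\rho_i=1$. Set $\hat\omega=\hat\omega_{\boldsymbol\sigma,\boldsymbol\rho}(\Theta)$ and $\omega_{\boldsymbol\eta}=\omega_{\boldsymbol\sigma,\boldsymbol\rho}(\Theta,\boldsymbol\eta)$. Suppose $\hat\omega<(1-\rho_n)^{-1}$. Then $$\omega_{\boldsymbol\eta}\ \ge\ \begin{cases}\dfrac{1-(1-\rho_n)\hat\omega}{\rho_n} & \text{if }\hat\omega\ge\dfrac{1-\sigma_m}{1-\rho_n},\\[2ex] \dfrac{\sigma_m}{1-(1-\sigma_m)\hat\omega^{-1}} & \text{if }\hat\omega\le\dfrac{1-\sigma_m}{1-\rho_n},\end{cases}$$ where $(1-\rho_n)^{-1}$ is understood as $+\infty$ if $\rho_n=1$ (so that for $\rho_n=1$ only the second case occurs).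
   Context: For weights $\boldsymbol\sigma\in\mathbb{R}_{>0}^m$, $\boldsymbol\rho\in\mathbb{R}_{>0}^n$ put $|\mathbf x|_{\boldsymbol\sigma}=\max_{1\le j\le m}|x_j|^{1/\sigma_j}$ for $\mathbf x\in\mathbb{R}^m$ and $|\mathbf y|_{\boldsymbol\rho}=\max_{1\le i\le n}|y_i|^{1/\rho_i}$ for $\mathbf y\in\mathbb{R}^n$. The uniform weighted Diophantine exponent $\hat\omega_{\boldsymbol\sigma,\boldsymbol\rho}(\Theta)\in[1,+\infty]$ is the supremum of real $\gamma$ such that the system $|\mathbf x|_{\boldsymbol\sigma}\le t$, $|\Theta\mathbf x-\mathbf y|_{\boldsymbol\rho}\le t^{-\gamma}$ admits nonzero solutions $(\mathbf x,\mathbf y)\in\mathbb{Z}^m\times\mathbb{Z}^n$ for every $t$ large enough. The inhomogeneous weighted Diophantine exponent $\omega_{\boldsymbol\sigma,\boldsymbol\rho}(\Theta,\boldsymbol\eta)$ is the supremum of real $\gamma$ such that the system $|\mathbf x|_{\boldsymbol\sigma}\le t$, $|\Theta\mathbf x-\mathbf y-\boldsymbol\eta|_{\boldsymbol\rho}\le t^{-\gamma}$ admits nonzero solutions $(\mathbf x,\mathbf y)\in\mathbb{Z}^m\times\mathbb{Z}^n$ for some arbitrarily large $t$ (i.e. for every $T$ there is $t\ge T$ for which a nonzero integer solution exists). *)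

theory Defs
  imports "HOL-Analysis.Analysis"
begin

text \<open>
  Dimensions are cardinalities of finite index types. The index types carry an order because the
  weights are listed in non-increasing order; on a finite type every linear order is a
  well-order, so the class \<open>wellorder\<close> is no restriction.
\<close>

definition weights :: "real ^ 'k::{finite,wellorder} \<Rightarrow> bool" where
  "weights w \<longleftrightarrow>
     (\<forall>i. 0 < w $ i) \<and> (\<forall>i j. i \<le> j \<longrightarrow> w $ j \<le> w $ i) \<and> (\<Sum>i\<in>UNIV. w $ i) = 1"

definition last_weight :: "real ^ 'k::{finite,wellorder} \<Rightarrow> real" where
  "last_weight w = w $ Max UNIV"

definition weighted_norm :: "real ^ 'k::finite \<Rightarrow> real ^ 'k \<Rightarrow> real" where
  "weighted_norm w x = (MAX i. \<bar>x $ i\<bar> powr (1 / w $ i))"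

definition real_vec :: "int ^ 'k \<Rightarrow> real ^ 'k::finite" where
  "real_vec x = (\<chi> i. real_of_int (x $ i))"

definition uniform_exponent ::
    "real ^ 'm::finite \<Rightarrow> real ^ 'n::finite \<Rightarrow> real ^ 'm ^ 'n \<Rightarrow> ereal" where
  "uniform_exponent \<sigma> \<rho> \<Theta> =
     Sup {ereal \<gamma> | \<gamma>. \<forall>\<^sub>F t in at_top. \<exists>(x :: int ^ 'm) (y :: int ^ 'n). (x, y) \<noteq> (0, 0) \<and>
       weighted_norm \<sigma> (real_vec x) \<le> t \<and>
       weighted_norm \<rho> (\<Theta> *v real_vec x - real_vec y) \<le> t powr (- \<gamma>)}"

definition inhomogeneous_exponent ::
    "real ^ 'm::finite \<Rightarrow> real ^ 'n::finite \<Rightarrow> real ^ 'm ^ 'n \<Rightarrow> real ^ 'n \<Rightarrow> ereal" where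
  "inhomogeneous_exponent \<sigma> \<rho> \<Theta> \<eta> =
     Sup {ereal \<gamma> | \<gamma>. \<forall>T. \<exists>t\<ge>T. \<exists>(x :: int ^ 'm) (y :: int ^ 'n). (x, y) \<noteq> (0, 0) \<and>
       weighted_norm \<sigma> (real_vec x) \<le> t \<and>
       weighted_norm \<rho> (\<Theta> *v real_vec x - real_vec y - \<eta>) \<le> t powr (- \<gamma>)}"

text \<open>
  Bounds on exponents are stated in \<open>ereal\<close>, where \<open>1 / 0 = \<infinity>\<close>; this is the intended value of
  \<open>1 / (1 - \<rho>\<^sub>n)\<close> for \<open>\<rho>\<^sub>n = 1\<close>.
\<close>

end

theory Submission
  imports Defs "HOL-Real_Asymp.Real_Asymp"
begin

text \<open>
  Integer points \<open>z = (x, y)\<close> are measured by the primal coordinates \<open>(x, y - \<Theta> x)\<close>, and integer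
  points \<open>w = (u, v)\<close> by the dual coordinates \<open>(u + \<Theta>\<^sup>T v, v)\<close>. The two resulting lattices in
  \<open>\<real>\<^bsup>m + n\<^esup>\<close> are dual to each other. The dual system with exponent \<open>\<alpha>\<close> asks for a nonzero \<open>w\<close> with
  \<open>|v|\<^sub>\<rho> \<le> R\<close> and \<open>|u + \<Theta>\<^sup>T v|\<^sub>\<sigma> \<le> R\<^bsup>- \<alpha>\<^esup>\<close>. It links the two exponents in the theorem.

  The inhomogeneous exponent: if a box contains no nonzero point of the dual lattice, then the
  polar box, enlarged by a constant, covers the space modulo the primal lattice
  (\<open>covering_radius\<close>, \<open>lattice_covering\<close>). So if the dual system with exponent \<open>1 / \<gamma>\<close> is
  unsolvable for arbitrarily large \<open>R\<close>, then \<open>\<gamma>\<close> is a lower bound for the inhomogeneous exponent,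
  whatever \<open>\<eta>\<close> (\<open>inhomogeneous_exponent_ge\<close>).

  The uniform exponent: if the dual system with exponent \<open>\<alpha>\<close> is solvable for all large \<open>R\<close>, then
  the uniform exponent is at least every \<open>\<gamma> \<ge> 1\<close> with \<open>(\<gamma> - 1) / \<rho>\<^sub>n \<le> \<gamma> - 1 / \<alpha>\<close> and
  \<open>(\<gamma> - 1) / \<sigma>\<^sub>m \<le> \<alpha> \<gamma> - 1\<close> (\<open>uniform_transference\<close>). For a given \<open>t\<close>, one or both of two
  consecutive minimal points of the dual system, chosen so that the product of consecutive heights
  crosses the threshold \<open>t\<^bsup>\<gamma> + 1 / \<alpha>\<^esup>\<close> there, force a nonzero primal point into a constant
  multiple of the box with half-sides \<open>t\<^bsup>\<sigma>\<^sub>j\<^esup>\<close> and \<open>t\<^bsup>- \<gamma> \<rho>\<^sub>i\<^esup>\<close>. The reason is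
  \<open>lattice_point_in_box\<close>: if a constant multiple of the box contained no such point, then short
  dual vectors would span the space, and completing the minimal points by some of them to a basis
  would give an integer matrix with determinant strictly between \<open>0\<close> and \<open>1\<close> in absolute value.

  Now let \<open>\<omega>\<close> be the uniform exponent and let \<open>\<gamma> > 0\<close> be smaller than both
  \<open>(1 - (1 - \<rho>\<^sub>n) \<omega>) / \<rho>\<^sub>n\<close> and \<open>\<sigma>\<^sub>m / (1 - (1 - \<sigma>\<^sub>m) / \<omega>)\<close>. The transference conditions with
  \<open>\<alpha> = 1 / \<gamma>\<close> then hold for some exponent larger than \<open>\<omega>\<close>, so the dual system cannot be solvable
  for all large \<open>R\<close>, and \<open>\<gamma>\<close> is a lower bound for the inhomogeneous exponent. The smaller of the
  two expressions is the one singled out by the case distinction.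
\<close>

section \<open>The covering radius of a lattice with long dual vectors\<close>

text \<open>
  The vectors of \<open>U\<close> whose inner products with all elements of \<open>L\<close> are integers. For a lattice \<open>L\<close>
  spanning the subspace \<open>U\<close> this is the dual lattice.
\<close>

definition dual_in :: "'a::real_inner set \<Rightarrow> 'a set \<Rightarrow> 'a set" where
  "dual_in U L = {w \<in> U. \<forall>z\<in>L. w \<bullet> z \<in> \<int>}"

lemma subgroup_scale_int:
  fixes L :: "'a::real_vector set"
  assumes "0 \<in> L" and diff: "\<And>x y. x \<in> L \<Longrightarrow> y \<in> L \<Longrightarrow> x - y \<in> L" and "z \<in> L"
  shows "of_int n *\<^sub>R z \<in> L"
proof -
  have neg: "- x \<in> L" if "x \<in> L" for x
    using diff[OF assms(1) that] by simp
  have nat: "of_nat k *\<^sub>R z \<in> L" for k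
  proof (induction k)
    case (Suc k)
    have "of_nat k *\<^sub>R z - (- z) \<in> L"
      using Suc neg[OF assms(3)] diff by blast
    then show ?case by (simp add: algebra_simps)
  qed (use assms in simp)
  show ?thesis
  proof (cases n)
    case (nonneg k)
    then show ?thesis using nat[of k] by simp
  next
    case (neg k)
    then show ?thesis using nat[of "Suc k"] \<open>\<And>x. x \<in> L \<Longrightarrow> - x \<in> L\<close> by (metis of_int_minus of_int_of_nat_eq scaleR_minus_left)
  qed
qed

text \<open>
  A dual vector whose length is within the factor \<open>11 / 10\<close> of the infimum is primitive, because a
  proper integral divisor of it would be a dual vector of at most half its length. Working with a
  near-minimum makes it unnecessary to know that \<open>L\<close> or its dual is discrete.
\<close>

lemma near_shortest_dual:
  fixes L U :: "'a::real_inner set"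
  assumes "subspace U" and "0 \<in> L" and diff: "\<And>x y. x \<in> L \<Longrightarrow> y \<in> L \<Longrightarrow> x - y \<in> L"
    and sep: "\<And>w. w \<in> U \<Longrightarrow> w \<noteq> 0 \<Longrightarrow> \<exists>z\<in>L. w \<bullet> z \<noteq> 0"
    and r: "0 < r" "\<And>w. w \<in> dual_in U L \<Longrightarrow> w \<noteq> 0 \<Longrightarrow> r \<le> norm w"
    and "w1 \<in> dual_in U L" "w1 \<noteq> 0"
  obtains w z \<mu> where "w \<in> dual_in U L" "w \<noteq> 0" "z \<in> L" "w \<bullet> z = 1" "r \<le> \<mu>" "norm w < 11 / 10 * \<mu>"
    "\<And>w. w \<in> dual_in U L \<Longrightarrow> w \<noteq> 0 \<Longrightarrow> \<mu> \<le> norm w"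
proof -
  define N where "N = norm ` (dual_in U L - {0})"
  define \<mu> where "\<mu> = Inf N"
  have ne: "N \<noteq> {}" and bdd: "bdd_below N"
    using assms(7,8) by (auto simp: N_def intro!: bdd_belowI2[where m=0])
  have r\<mu>: "r \<le> \<mu>"
    unfolding \<mu>_def by (rule cInf_greatest[OF ne]) (use r(2) in \<open>auto simp: N_def\<close>)
  have low: "\<mu> \<le> norm w" if "w \<in> dual_in U L" "w \<noteq> 0" for w
    unfolding \<mu>_def by (rule cInf_lower[OF _ bdd]) (use that in \<open>auto simp: N_def\<close>)
  have "Inf N < 11 / 10 * \<mu>" using r r\<mu> unfolding \<mu>_def by simp
  then obtain w where w: "w \<in> dual_in U L" "w \<noteq> 0" "norm w < 11 / 10 * \<mu>"
    using cInf_lessD[OF ne] unfolding N_def by blast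
  have wU: "w \<in> U" and wint: "w \<bullet> z \<in> \<int>" if "z \<in> L" for z
    using w(1) that by (auto simp: dual_in_def)
  obtain z1 where z1: "z1 \<in> L" "w \<bullet> z1 \<noteq> 0"
    using sep w wU by (metis (mono_tags, lifting) dual_in_def mem_Collect_eq)
  have ex: "\<exists>k. \<exists>z\<in>L. k > (0::nat) \<and> w \<bullet> z = real k"
  proof -
    obtain i where i: "w \<bullet> z1 = of_int i" using wint[OF z1(1)] by (auto elim: Ints_cases)
    show ?thesis
    proof (cases "i > 0")
      case True
      then show ?thesis using i z1 by (intro exI[of _ "nat i"]) auto
    next
      case False
      have "- z1 \<in> L" using diff[OF assms(2) z1(1)] by simp
      then show ?thesis using False i z1
        by (intro exI[of _ "nat (-i)"]) (auto intro!: bexI[of _ "- z1"])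
    qed
  qed
  define g where "g = (LEAST k. \<exists>z\<in>L. k > (0::nat) \<and> w \<bullet> z = real k)"
  obtain z where z: "z \<in> L" "g > 0" "w \<bullet> z = real g"
    using LeastI_ex[OF ex] unfolding g_def by auto
  have min: "g \<le> k" if "y \<in> L" "k > 0" "w \<bullet> y = real k" for k y
    unfolding g_def by (rule Least_le) (use that in auto)
  have "(1 / real g) *\<^sub>R w \<in> dual_in U L"
    unfolding dual_in_def
  proof (intro CollectI conjI ballI)
    show "(1 / real g) *\<^sub>R w \<in> U" using w(1) assms(1) by (auto simp: dual_in_def subspace_scale)
    fix y assume y: "y \<in> L"
    obtain i where i: "w \<bullet> y = of_int i" using wint[OF y] by (auto elim: Ints_cases)
    define q where "q = i div int g"
    have yq: "y - of_int q *\<^sub>R z \<in> L"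
      by (intro diff y subgroup_scale_int assms z)
    have "w \<bullet> (y - of_int q *\<^sub>R z) = real_of_int (i - q * int g)"
      using i z by (simp add: inner_diff_right)
    also have "i - q * int g = i mod int g"
      unfolding q_def by (simp add: minus_div_mult_eq_mod)
    finally have val: "w \<bullet> (y - of_int q *\<^sub>R z) = real (nat (i mod int g))"
      using z(2) by simp
    have "0 \<le> i mod int g" "i mod int g < int g" using z(2) by simp_all
    moreover have "\<not> nat (i mod int g) > 0"
      using min[OF yq _ val] calculation by linarith
    ultimately have "i mod int g = 0" by linarith
    then have "i = q * int g" unfolding q_def using div_mult_mod_eq[of i "int g"] by simp
    then have "(1 / real g) *\<^sub>R w \<bullet> y = of_int q" using i z(2) by simp
    then show "(1 / real g) *\<^sub>R w \<bullet> y \<in> \<int>" by simp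
  qed
  then have "\<mu> \<le> norm ((1 / real g) *\<^sub>R w)" using w(2) z(2) by (intro low) auto
  then have "\<mu> * real g \<le> norm w" using z(2) by (simp add: field_simps)
  also have "\<dots> < 11/10 * \<mu>" by (rule w)
  finally have "real g < 11/10" using r r\<mu> by (metis less_le_trans mult.commute mult_less_cancel_right not_less_iff_gr_or_eq)
  then have "g = 1" using z(2) by linarith
  then show ?thesis using that[OF w(1,2) z(1) _ r\<mu> w(3) low] z(3) by simp
qed

text \<open>
  A lattice in \<open>U\<close> all of whose nonzero dual vectors have length at least \<open>r\<close> has covering radius
  at most \<open>2 ^ dim U / r\<close>. The proof is by induction on the dimension. If \<open>w\<close> is a nearly shortest
  dual vector, then \<open>L\<close> lies in the parallel hyperplanes on which \<open>w\<close> takes integer values, whose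
  distance is at most \<open>1 / r\<close>; the dual of the section of \<open>L\<close> by the hyperplane orthogonal to \<open>w\<close>
  is the orthogonal projection of the dual of \<open>L\<close>, and size reduction against \<open>w\<close> shows that its
  nonzero vectors have length at least \<open>2 / 3 * r\<close>. The two separation hypotheses say that \<open>L\<close> and
  its dual both span \<open>U\<close>.
\<close>

lemma covering_radius:
  fixes L U :: "'a::euclidean_space set"
  assumes "subspace U" and "L \<subseteq> U" and "0 \<in> L"
    and "\<And>x y. x \<in> L \<Longrightarrow> y \<in> L \<Longrightarrow> x - y \<in> L"
    and "\<And>w. w \<in> U \<Longrightarrow> w \<noteq> 0 \<Longrightarrow> \<exists>z\<in>L. w \<bullet> z \<noteq> 0"
    and "\<And>x. x \<in> U \<Longrightarrow> x \<noteq> 0 \<Longrightarrow> \<exists>w\<in>dual_in U L. w \<bullet> x \<noteq> 0"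
    and "0 < r" and "\<And>w. w \<in> dual_in U L \<Longrightarrow> w \<noteq> 0 \<Longrightarrow> r \<le> norm w"
    and "x \<in> U"
  shows "\<exists>z\<in>L. norm (x - z) \<le> 2 ^ dim U / r"
  using assms
proof (induction "dim U" arbitrary: U L r x rule: less_induct)
  case less
  note U = less.prems(1) and LU = less.prems(2) and L0 = less.prems(3) and diff = less.prems(4)
    and sep = less.prems(5) and sepd = less.prems(6) and r = less.prems(7,8) and xU = less.prems(9)
  show ?case
  proof (cases "x = 0")
    case True
    then show ?thesis using L0 r(1) by (intro bexI[of _ 0]) auto
  next
    case False
    then obtain w1 where w1: "w1 \<in> dual_in U L" "w1 \<noteq> 0" using sepd xU by force
    obtain w z0 \<mu> where w: "w \<in> dual_in U L" "w \<noteq> 0" and z0: "z0 \<in> L" "w \<bullet> z0 = 1"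
      and \<mu>: "r \<le> \<mu>" "norm w < 11 / 10 * \<mu>" "\<And>w. w \<in> dual_in U L \<Longrightarrow> w \<noteq> 0 \<Longrightarrow> \<mu> \<le> norm w"
      by (rule near_shortest_dual[of U L r w1]) (use U L0 diff sep r w1 in \<open>blast+\<close>)
    have wU: "w \<in> U" and wint: "\<And>z. z \<in> L \<Longrightarrow> w \<bullet> z \<in> \<int>" using w(1) by (auto simp: dual_in_def)
    define V where "V = U \<inter> {v. w \<bullet> v = 0}"
    define K where "K = L \<inter> {v. w \<bullet> v = 0}"
    have V: "subspace V" unfolding V_def by (intro subspace_inter U subspace_hyperplane)
    have "w \<notin> V" using w(2) by (simp add: V_def)
    then have "V \<subset> U" using wU unfolding V_def by blast
    then have dimV: "dim V < dim U"
      using U V by (metis dim_psubset span_eq_iff)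
    have sect: "z - (w \<bullet> z) *\<^sub>R z0 \<in> K" if z: "z \<in> L" for z
    proof -
      obtain i where "w \<bullet> z = of_int i" using wint[OF z] by (auto elim: Ints_cases)
      then have "z - (w \<bullet> z) *\<^sub>R z0 \<in> L" using subgroup_scale_int[OF L0 diff z0(1)] diff z by simp
      then show ?thesis using z0 by (simp add: K_def inner_diff_right)
    qed
    \<comment> \<open>Dual vectors of the section lift to dual vectors of \<open>L\<close>; the lift is unique up to
        integer multiples of \<open>w\<close>, whence the freedom in \<open>c\<close>.\<close>
    have ext: "u - c *\<^sub>R w \<in> dual_in U L" if u: "u \<in> dual_in V K" and c: "c - u \<bullet> z0 \<in> \<int>" for u c
      unfolding dual_in_def
    proof (intro CollectI conjI ballI)
      show "u - c *\<^sub>R w \<in> U" using u wU U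
        by (auto simp: dual_in_def V_def intro: subspace_diff subspace_scale)
      fix z assume z: "z \<in> L"
      have "(u - c *\<^sub>R w) \<bullet> z = u \<bullet> (z - (w \<bullet> z) *\<^sub>R z0) - (c - u \<bullet> z0) * (w \<bullet> z)"
        by (simp add: algebra_simps)
      moreover have "u \<bullet> (z - (w \<bullet> z) *\<^sub>R z0) \<in> \<int>" using u sect[OF z] by (auto simp: dual_in_def)
      ultimately show "(u - c *\<^sub>R w) \<bullet> z \<in> \<int>" using c wint[OF z] by (metis Ints_diff Ints_mult)
    qed
    have minK: "2 / 3 * r \<le> norm u" if u: "u \<in> dual_in V K" "u \<noteq> 0" for u
    proof -
      have uw: "u \<bullet> w = 0" using u by (auto simp: dual_in_def V_def inner_commute)
      \<comment> \<open>Among the lifts of \<open>u\<close>, take the one with the smallest component along \<open>w\<close>.\<close>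
      define c where "c = u \<bullet> z0 - of_int (round (u \<bullet> z0))"
      have "\<bar>c\<bar> \<le> 1 / 2" unfolding c_def using of_int_round_abs_le[of "u \<bullet> z0"] by (simp add: abs_minus_commute)
      then have c2: "c\<^sup>2 \<le> 1 / 4" using power_mono[of "\<bar>c\<bar>" "1/2" 2] by (simp add: power2_eq_square)
      have "u - c *\<^sub>R w \<noteq> 0"
      proof
        assume "u - c *\<^sub>R w = 0"
        then have "u \<bullet> u = 0" using uw by (metis eq_iff_diff_eq_0 inner_scaleR_right mult_zero_right)
        then show False using u by simp
      qed
      moreover have "u - c *\<^sub>R w \<in> dual_in U L" by (rule ext[OF u(1)]) (simp add: c_def)
      ultimately have "\<mu>\<^sup>2 \<le> (norm (u - c *\<^sub>R w))\<^sup>2"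
        using \<mu> r(1) by (intro power_mono) auto
      also have "\<dots> = (norm u)\<^sup>2 + c\<^sup>2 * (norm w)\<^sup>2"
        using uw unfolding power2_norm_eq_inner by (simp add: algebra_simps inner_commute power2_eq_square)
      also have "c\<^sup>2 * (norm w)\<^sup>2 \<le> 1 / 4 * (11 / 10 * \<mu>)\<^sup>2"
        using \<mu> c2 by (intro mult_mono power_mono) auto
      finally have "\<mu>\<^sup>2 \<le> (norm u)\<^sup>2 + 1 / 4 * (11 / 10 * \<mu>)\<^sup>2" by simp
      moreover have "(11 / 10 * \<mu>)\<^sup>2 = 121 / 100 * \<mu>\<^sup>2" "(2 / 3 * r)\<^sup>2 = 4 / 9 * r\<^sup>2"
        by (simp_all add: power2_eq_square)
      moreover have "r\<^sup>2 \<le> \<mu>\<^sup>2" using \<mu> r by (intro power_mono) auto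
      moreover have "0 \<le> \<mu>\<^sup>2" by simp
      ultimately have "(2 / 3 * r)\<^sup>2 \<le> (norm u)\<^sup>2" by linarith
      then show ?thesis by (rule power2_le_imp_le) simp
    qed
    have sepK: "\<exists>z\<in>K. u \<bullet> z \<noteq> 0" if u: "u \<in> V" "u \<noteq> 0" for u
    proof -
      have uw: "u \<bullet> w = 0" using u by (auto simp: V_def inner_commute)
      have "u - (u \<bullet> z0) *\<^sub>R w \<noteq> 0" using u uw
        by (metis eq_iff_diff_eq_0 inner_eq_zero_iff inner_scaleR_right mult_zero_right)
      moreover have "u - (u \<bullet> z0) *\<^sub>R w \<in> U" using u wU U by (auto simp: V_def intro: subspace_diff subspace_scale)
      ultimately obtain z where z: "z \<in> L" "(u - (u \<bullet> z0) *\<^sub>R w) \<bullet> z \<noteq> 0" using sep by blast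
      then have "u \<bullet> (z - (w \<bullet> z) *\<^sub>R z0) \<noteq> 0" by (simp add: algebra_simps)
      then show ?thesis using sect[OF z(1)] by blast
    qed
    have sepdK: "\<exists>u\<in>dual_in V K. u \<bullet> y \<noteq> 0" if y: "y \<in> V" "y \<noteq> 0" for y
    proof -
      obtain v where v: "v \<in> dual_in U L" "v \<bullet> y \<noteq> 0" using sepd y by (auto simp: V_def)
      define u where "u = v - ((w \<bullet> v) / (w \<bullet> w)) *\<^sub>R w"
      have "u \<in> V" using v wU U w(2)
        by (auto simp: u_def V_def dual_in_def inner_diff_right intro: subspace_diff subspace_scale)
      moreover have "u \<bullet> z = v \<bullet> z" if "w \<bullet> z = 0" for z
        using that by (simp add: u_def inner_diff_left)
      ultimately show ?thesis using v y by (intro bexI[of _ u]) (auto simp: dual_in_def K_def V_def)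
    qed
    \<comment> \<open>Move \<open>x\<close> to the nearest of the parallel hyperplanes and apply the induction
        hypothesis there.\<close>
    define n where "n = round (x \<bullet> w)"
    define f where "f = x \<bullet> w - of_int n"
    have f: "\<bar>f\<bar> \<le> 1 / 2" unfolding f_def n_def using of_int_round_abs_le[of "x \<bullet> w"]
      by (simp add: abs_minus_commute)
    define x' where "x' = x - of_int n *\<^sub>R z0 - (f / (w \<bullet> w)) *\<^sub>R w"
    have "x' \<in> V" using xU wU z0 LU U w(2)
      by (auto simp: x'_def V_def f_def inner_diff_right inner_commute intro!: subspace_diff subspace_scale)
    then obtain z' where z': "z' \<in> K" "norm (x' - z') \<le> 2 ^ dim V / (2 / 3 * r)"
      using less.hyps[OF dimV V, of K "2 / 3 * r" x'] minK sepK sepdK r(1) L0 LU diff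
      by (force simp: K_def V_def inner_diff_right)
    have "z' + of_int n *\<^sub>R z0 \<in> L"
      using diff[of z' "of_int (- n) *\<^sub>R z0"] subgroup_scale_int[OF L0 diff z0(1), of "- n"] z'(1) by (simp add: K_def)
    moreover have "norm (x - (z' + of_int n *\<^sub>R z0)) \<le> 2 ^ dim U / r"
    proof -
      have "norm (x - (z' + of_int n *\<^sub>R z0)) = norm ((x' - z') + (f / (w \<bullet> w)) *\<^sub>R w)"
        by (simp add: x'_def algebra_simps)
      also have "\<dots> \<le> norm (x' - z') + norm ((f / (w \<bullet> w)) *\<^sub>R w)" by (rule norm_triangle_ineq)
      also have "norm ((f / (w \<bullet> w)) *\<^sub>R w) = \<bar>f\<bar> / norm w"
        using w(2) by (simp add: power2_norm_eq_inner[symmetric] power2_eq_square)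
      also have "\<bar>f\<bar> / norm w \<le> (1 / 2) / r"
        using f r w by (intro frac_le) auto
      also have "norm (x' - z') \<le> 2 ^ (dim U - 1) / (2 / 3 * r)"
      proof -
        have "(2::real) ^ dim V \<le> 2 ^ (dim U - 1)" using dimV by (intro power_increasing) auto
        then have "2 ^ dim V / (2 / 3 * r) \<le> 2 ^ (dim U - 1) / (2 / 3 * r)"
          using r(1) by (intro divide_right_mono) auto
        then show ?thesis using z'(2) by linarith
      qed
      also have "2 ^ (dim U - 1) / (2 / 3 * r) + (1 / 2) / r = (3 / 2 * 2 ^ (dim U - 1) + 1 / 2) / r"
      proof -
        have "a / (2 / 3 * r) + (1 / 2) / r = (3 / 2 * a + 1 / 2) / r" for a
          using r(1) by (simp add: field_simps)
        then show ?thesis .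
      qed
      also have "\<dots> \<le> 2 ^ dim U / r"
      proof (intro divide_right_mono)
        have "(2::real) ^ dim U = 2 * 2 ^ (dim U - 1)"
          using dimV by (metis gr_implies_not0 power_eq_if)
        moreover have "(1::real) \<le> 2 ^ (dim U - 1)" by simp
        ultimately show "3 / 2 * 2 ^ (dim U - 1) + 1 / 2 \<le> (2::real) ^ dim U" by linarith
      qed (use r in simp)
      finally show ?thesis by simp
    qed
    ultimately show ?thesis by blast
  qed
qed

section \<open>Pairs of dual bases\<close>

text \<open>
  Products with transposed matrices are kept in the form \<open>transpose A *v x\<close>.
\<close>

declare transpose_matrix_vector [simp del]

lemma real_vec_simps [simp]:
  "real_vec 0 = 0" "real_vec (x - y) = real_vec x - real_vec y"
  "real_vec (axis j 1) = axis j 1" "real_vec x = 0 \<longleftrightarrow> x = 0" "real_vec x $ i = of_int (x $ i)"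
  by (auto simp: real_vec_def vec_eq_iff axis_def)

lemma matrix_vector_inner: "(A *v (x :: real ^ 'k)) \<bullet> y = x \<bullet> (transpose A *v y)"
  by (metis dot_lmul_matrix transpose_matrix_vector inner_commute)

text \<open>
  The columns of \<open>A\<close> and \<open>B\<close> generate dual lattices. If the box with half-sides \<open>s i\<close> contains no
  nonzero point of the lattice of \<open>B\<close>, then the translates of the polar box, enlarged by a
  constant, by the points of the lattice of \<open>A\<close> cover the whole space.
\<close>

lemma lattice_covering:
  fixes A B :: "real ^ 'k ^ 'k" and s :: "'k::finite \<Rightarrow> real"
  assumes AB: "transpose A ** B = mat 1" and s: "\<And>i. 0 < s i"
    and big: "\<And>w :: int ^ 'k. w \<noteq> 0 \<Longrightarrow> \<exists>i. s i < \<bar>(B *v real_vec w) $ i\<bar>"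
  shows "\<exists>z :: int ^ 'k. \<forall>i. \<bar>(A *v real_vec z) $ i - x $ i\<bar> \<le> 2 ^ CARD('k) / s i"
proof -
  have BA: "B ** transpose A = mat 1" using AB by (simp add: matrix_left_right_inverse)
  define f where "f z = (\<chi> i. s i * (A *v real_vec z) $ i)" for z :: "int ^ 'k"
  define h where "h u = (\<chi> i. s i * u $ i)" for u :: "real ^ 'k"
  have inner_f: "u \<bullet> f z = (transpose A *v h u) \<bullet> real_vec z" for u z
  proof -
    have "u \<bullet> f z = (A *v real_vec z) \<bullet> h u"
      by (simp add: f_def h_def inner_vec_def mult_ac)
    then show ?thesis by (metis matrix_vector_inner inner_commute)
  qed
  have Ah: "B *v (transpose A *v h u) = h u" for u
    by (simp add: matrix_vector_mul_assoc BA)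
  have h0: "h u = 0 \<longleftrightarrow> u = 0" for u
    using s by (auto simp: h_def vec_eq_iff) (metis less_irrefl)
  define L where "L = range f"
  \<comment> \<open>Rescaling by \<open>s\<close> turns the box into the unit box, so that nonzero dual vectors have norm at
      least \<open>1\<close>.\<close>
  have "\<exists>z\<in>L. norm ((\<chi> i. s i * x $ i) - z) \<le> 2 ^ dim (UNIV :: (real ^ 'k) set) / 1"
  proof (rule covering_radius)
    show "0 \<in> L" unfolding L_def by (rule range_eqI[of _ _ 0]) (simp add: f_def vec_eq_iff)
    show "a - b \<in> L" if ab: "a \<in> L" "b \<in> L" for a b
    proof -
      obtain y z where "a = f y" "b = f z" using ab by (auto simp: L_def)
      then have "a - b = f (y - z)"
        by (simp add: f_def vec_eq_iff matrix_vector_mult_diff_distrib algebra_simps)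
      then show ?thesis by (simp add: L_def)
    qed
    show "\<exists>z\<in>L. w \<bullet> z \<noteq> 0" if "w \<noteq> 0" for w
    proof -
      have "transpose A *v h w \<noteq> 0" using Ah[of w] h0 that by (metis matrix_vector_mult_0_right)
      then obtain j where "(transpose A *v h w) $ j \<noteq> 0" by (auto simp: vec_eq_iff)
      then have "w \<bullet> f (axis j 1) \<noteq> 0" by (simp add: inner_f inner_axis)
      then show ?thesis by (auto simp: L_def)
    qed
    show "\<exists>w\<in>dual_in UNIV L. w \<bullet> x \<noteq> 0" if "x \<noteq> 0" for x
    proof -
      define y where "y = (\<chi> i. x $ i / s i)"
      have "y \<noteq> 0" using that s by (auto simp: y_def vec_eq_iff) (metis less_irrefl)
      moreover have "A *v (transpose B *v y) = y"
        using BA by (metis matrix_left_right_inverse matrix_transpose_mul matrix_vector_mul_assoc matrix_vector_mul_lid transpose_mat transpose_transpose)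
      ultimately have "transpose B *v y \<noteq> 0" by (metis matrix_vector_mult_0_right)
      then obtain j where j: "(transpose B *v y) $ j \<noteq> 0" by (auto simp: vec_eq_iff)
      define w where "w = (\<chi> i. (B *v axis j 1) $ i / s i)"
      have hw: "h w = B *v axis j 1"
        using s by (simp add: h_def w_def vec_eq_iff) (metis less_irrefl)
      have "w \<bullet> x = (B *v axis j 1) \<bullet> y" by (simp add: w_def y_def inner_vec_def)
      also have "\<dots> = (transpose B *v y) $ j"
        by (simp only: matrix_vector_inner inner_axis') simp
      finally have "w \<bullet> x \<noteq> 0" using j by simp
      moreover have "w \<in> dual_in UNIV L"
        by (auto simp: dual_in_def L_def inner_f hw matrix_vector_mul_assoc AB inner_axis inner_commute)
      ultimately show ?thesis by blast
    qed
    show "1 \<le> norm w" if w: "w \<in> dual_in UNIV L" "w \<noteq> 0" for w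
    proof -
      have int: "(transpose A *v h w) $ j \<in> \<int>" for j
      proof -
        have "w \<bullet> f (axis j 1) \<in> \<int>" using w by (auto simp: dual_in_def L_def)
        then show ?thesis by (simp add: inner_f inner_axis)
      qed
      define v :: "int ^ 'k" where "v = (\<chi> j. \<lfloor>(transpose A *v h w) $ j\<rfloor>)"
      have rv: "real_vec v = transpose A *v h w"
        using int by (simp add: vec_eq_iff v_def)
      then have "B *v real_vec v = h w" by (simp add: Ah)
      moreover have "v \<noteq> 0" using calculation h0 w by (metis matrix_vector_mult_0_right real_vec_simps(1))
      ultimately obtain i where "s i < \<bar>h w $ i\<bar>" using big by metis
      then have "s i * 1 < s i * \<bar>w $ i\<bar>" using s[of i] by (simp add: h_def abs_mult)
      then have "1 < \<bar>w $ i\<bar>" using s[of i] by (metis mult_less_cancel_left_pos)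
      then show ?thesis using component_le_norm_cart[of w i] by linarith
    qed
  qed auto
  then obtain z where z: "norm ((\<chi> i. s i * x $ i) - f z) \<le> 2 ^ CARD('k)" by (auto simp: L_def)
  show ?thesis
  proof (intro exI allI)
    fix i
    have "\<bar>s i * x $ i - f z $ i\<bar> \<le> 2 ^ CARD('k)"
      using component_le_norm_cart[of "(\<chi> i. s i * x $ i) - f z" i] z by simp
    moreover have "s i * x $ i - f z $ i = s i * (x $ i - (A *v real_vec z) $ i)"
      by (simp add: f_def algebra_simps)
    ultimately have "s i * \<bar>(A *v real_vec z) $ i - x $ i\<bar> \<le> 2 ^ CARD('k)"
      using s[of i] by (simp add: abs_mult abs_minus_commute)
    then show "\<bar>(A *v real_vec z) $ i - x $ i\<bar> \<le> 2 ^ CARD('k) / s i"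
      using s[of i] by (simp add: field_simps)
  qed
qed

section \<open>Lattice points in boxes\<close>

text \<open>
  The factor by which boxes in dimension \<open>d\<close> are enlarged in the existence results for lattice
  points.
\<close>

definition box_const :: "nat \<Rightarrow> real" where
  "box_const d = 2 * fact d * (real d + 2) * 2 ^ d"

lemma box_const_ge_1: "1 \<le> box_const d"
proof -
  have "(1::real) * 1 * 1 * 1 \<le> 2 * fact d * (real d + 2) * 2 ^ d"
    by (intro mult_mono) (auto intro: fact_ge_1 mult_nonneg_nonneg)
  then show ?thesis by (simp add: box_const_def)
qed

text \<open>
  If a box contains no nonzero point of the lattice of \<open>A\<close>, then the points of the dual lattice in
  a multiple of the polar box span the space: by the covering property there are such points near
  large multiples of the coordinate vectors.
\<close>

lemma small_dual_vectors_span: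
  fixes A B :: "real ^ 'k ^ 'k" and a :: "'k::finite \<Rightarrow> real"
  assumes AB: "transpose A ** B = mat 1" and a: "\<And>i. 0 < a i"
    and big: "\<And>z :: int ^ 'k. z \<noteq> 0 \<Longrightarrow> \<exists>i. a i < \<bar>(A *v real_vec z) $ i\<bar>"
  defines "M \<equiv> (real CARD('k) + 2) * 2 ^ CARD('k)"
  shows "span (real_vec ` {w :: int ^ 'k. \<forall>i. \<bar>(B *v real_vec w) $ i\<bar> \<le> M / a i}) = UNIV"
proof (rule ccontr)
  let ?W = "{w :: int ^ 'k. \<forall>i. \<bar>(B *v real_vec w) $ i\<bar> \<le> M / a i}"
  let ?e = "2 ^ CARD('k) :: real"
  define R where "R = (real CARD('k) + 1) * ?e"
  assume "span (real_vec ` ?W) \<noteq> UNIV"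
  then obtain y where y0: "y \<noteq> 0" and sub: "span (real_vec ` ?W) \<subseteq> {x. y \<bullet> x = 0}"
    using span_not_univ_subset_hyperplane by blast
  have y: "y \<bullet> real_vec w = 0" if "w \<in> ?W" for w
    using sub span_base[OF imageI[OF that]] by blast
  have "transpose (transpose A ** B) = mat 1" by (simp add: AB transpose_mat)
  then have BA: "transpose B ** A = mat 1" by (simp add: matrix_transpose_mul)
  define Y where "Y = A *v y"
  have Y0: "Y \<noteq> 0"
  proof
    assume "Y = 0"
    then have "transpose B *v (A *v y) = 0" by (simp add: Y_def)
    then show False using y0 by (simp add: matrix_vector_mul_assoc BA)
  qed
  define m where "m i = \<bar>Y $ i\<bar> / a i" for i
  have "Max (range m) \<in> range m" by (intro Max_in) auto
  then obtain k where "Max (range m) = m k" by blast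
  then have k: "m i \<le> m k" for i using Max_ge[of "range m" "m i"] by simp
  have "\<exists>w :: int ^ 'k. \<forall>i. \<bar>(B *v real_vec w) $ i - axis k (R / a k) $ i\<bar> \<le> ?e / a i"
    by (rule lattice_covering[OF BA a big])
  then obtain w :: "int ^ 'k" where w: "\<And>i. \<bar>(B *v real_vec w) $ i - axis k (R / a k) $ i\<bar> \<le> ?e / a i"
    by blast
  have "w \<in> ?W"
  proof (intro CollectI allI)
    fix i
    have "\<bar>axis k (R / a k) $ i\<bar> \<le> R / a i" using a[of i] by (auto simp: axis_def R_def)
    then have "\<bar>(B *v real_vec w) $ i\<bar> \<le> R / a i + ?e / a i" using w[of i] by linarith
    also have "\<dots> = M / a i" by (simp add: M_def R_def algebra_simps add_divide_distrib)
    finally show "\<bar>(B *v real_vec w) $ i\<bar> \<le> M / a i" .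
  qed
  then have "y \<bullet> (transpose A *v (B *v real_vec w)) = 0" using y by (simp add: matrix_vector_mul_assoc AB)
  then have "Y \<bullet> (B *v real_vec w) = 0" by (simp add: Y_def matrix_vector_inner)
  moreover have "Y \<bullet> (B *v real_vec w) = Y \<bullet> axis k (R / a k) + Y \<bullet> (B *v real_vec w - axis k (R / a k))"
    by (simp add: inner_diff_right)
  ultimately have "Y $ k * (R / a k) = - (\<Sum>i\<in>UNIV. Y $ i * ((B *v real_vec w) $ i - axis k (R / a k) $ i))"
    by (simp add: inner_axis) (simp add: inner_vec_def)
  then have "\<bar>Y $ k * (R / a k)\<bar> \<le> (\<Sum>i\<in>UNIV. \<bar>Y $ i * ((B *v real_vec w) $ i - axis k (R / a k) $ i)\<bar>)"
    by (simp add: sum_abs)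
  also have "\<dots> \<le> (\<Sum>i\<in>(UNIV :: 'k set). m k * ?e)"
  proof (rule sum_mono)
    fix i
    have "\<bar>Y $ i * ((B *v real_vec w) $ i - axis k (R / a k) $ i)\<bar> \<le> \<bar>Y $ i\<bar> * (?e / a i)"
      unfolding abs_mult using w[of i] by (intro mult_left_mono) auto
    also have "\<dots> = m i * ?e" by (simp add: m_def)
    also have "\<dots> \<le> m k * ?e" using k by simp
    finally show "\<bar>Y $ i * ((B *v real_vec w) $ i - axis k (R / a k) $ i)\<bar> \<le> m k * ?e" .
  qed
  finally have "m k * R \<le> real CARD('k) * (m k * ?e)"
    using a[of k] by (simp add: m_def abs_mult R_def)
  then have "m k * ?e \<le> 0" by (simp add: R_def algebra_simps)
  then have "m k \<le> 0" by (smt (verit) mult_pos_pos zero_less_power)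
  then have "m i \<le> 0" for i using k order_trans by blast
  then have "Y $ i = 0" for i using a[of i] by (simp add: m_def divide_le_0_iff) (metis less_le_not_le)
  then show False using Y0 by (simp add: vec_eq_iff)
qed

lemma abs_det_le:
  fixes N :: "real ^ 'k ^ 'k"
  assumes "\<And>p. p permutes UNIV \<Longrightarrow> (\<Prod>i\<in>UNIV. \<bar>N $ i $ p i\<bar>) \<le> C"
  shows "\<bar>det N\<bar> \<le> fact CARD('k) * C"
proof -
  have "\<bar>det N\<bar> \<le> (\<Sum>p | p permutes (UNIV :: 'k set). \<bar>of_int (sign p) * (\<Prod>i\<in>UNIV. N $ i $ p i)\<bar>)"
    unfolding det_def by (rule sum_abs)
  also have "\<dots> \<le> (\<Sum>p | p permutes (UNIV :: 'k set). C)"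
    by (intro sum_mono) (auto simp: abs_mult sign_def abs_prod intro: assms)
  also have "\<dots> = fact CARD('k) * C"
    by (simp add: card_permutations)
  finally show ?thesis .
qed

lemma det_in_Ints:
  fixes N :: "real ^ 'k ^ 'k"
  assumes "\<And>i j. N $ i $ j \<in> \<int>"
  shows "det N \<in> \<int>"
  unfolding det_def by (intro Ints_sum Ints_mult Ints_prod assms) auto

text \<open>
  A substitute for Minkowski's theorem that allows volumes smaller than \<open>1\<close>. Suppose that fewer
  than \<open>CARD('k)\<close> linearly independent dual vectors are given such that every product of their
  coordinates, one from each vector and scaled by the sides of the box, is bounded by the product
  of the half-sides of the box. Then a multiple of the box contains a nonzero lattice point.
  Otherwise the given vectors could be completed by short dual vectors to a basis. The determinant
  of its coordinates with respect to \<open>B\<close> would be a nonzero integer multiple of \<open>det B\<close>, hence at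
  least \<open>1\<close> in absolute value; but every term of its Leibniz expansion is smaller than
  \<open>1 / fact CARD('k)\<close>. For \<open>S = {}\<close> the hypothesis says that the product of the half-sides is at
  least \<open>1\<close>.
\<close>

lemma lattice_point_in_box:
  fixes A B :: "real ^ 'k ^ 'k" and a :: "'k::finite \<Rightarrow> real" and S :: "(real ^ 'k) set"
  assumes AB: "transpose A ** B = mat 1" and detB: "1 \<le> \<bar>det B\<bar>" and a: "\<And>i. 0 < a i"
    and S: "S \<subseteq> range real_vec" "independent S" "card S < CARD('k)"
    and bound: "\<And>\<phi>. (\<Prod>v\<in>S. \<bar>(B *v v) $ \<phi> v\<bar> * a (\<phi> v)) \<le> (\<Prod>i\<in>UNIV. a i)"
  shows "\<exists>z :: int ^ 'k. z \<noteq> 0 \<and> (\<forall>i. \<bar>(A *v real_vec z) $ i\<bar> \<le> box_const CARD('k) * a i)"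
proof (rule ccontr)
  let ?c = "box_const CARD('k)"
  define \<epsilon> :: real where "\<epsilon> = 1 / (2 * fact CARD('k))"
  have \<epsilon>: "0 < \<epsilon>" "\<epsilon> \<le> 1"
  proof -
    have "(1::real) \<le> fact CARD('k)" by (rule fact_ge_1)
    then show "0 < \<epsilon>" "\<epsilon> \<le> 1" unfolding \<epsilon>_def by (simp, subst divide_le_eq_1_pos) linarith+
  qed
  assume "\<not> ?thesis"
  then have big: "\<exists>i. ?c * a i < \<bar>(A *v real_vec z) $ i\<bar>" if "z \<noteq> 0" for z :: "int ^ 'k"
    using that by (meson linorder_not_less)
  define W :: "(real ^ 'k) set" where "W = real_vec ` {w. \<forall>i. \<bar>(B *v real_vec w) $ i\<bar> \<le> \<epsilon> / a i}"
  have "(real CARD('k) + 2) * 2 ^ CARD('k) / (?c * a i) = \<epsilon> / a i" for i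
  proof -
    have "M / (2 * f * M * b) = 1 / (2 * f) / b" if "0 < M" for M f b :: real
      using that by simp
    from this[of "(real CARD('k) + 2) * 2 ^ CARD('k)" "fact CARD('k)" "a i"] show ?thesis
      by (simp add: box_const_def \<epsilon>_def mult.assoc)
  qed
  then have spanW: "span W = UNIV"
    using small_dual_vectors_span[OF AB _ big] a box_const_ge_1[of "CARD('k)"]
    by (simp add: W_def)
  \<comment> \<open>Complete \<open>S\<close> by short dual vectors to a basis, the rows of an integer matrix \<open>H\<close>.\<close>
  obtain Q where Q: "S \<subseteq> Q" "Q \<subseteq> S \<union> W" "independent Q" "S \<union> W \<subseteq> span Q"
    using maximal_independent_subset_extend[of S "S \<union> W"] S(2) by blast
  have spanQ: "span Q = UNIV"
    using Q(4) spanW span_mono[of W "span Q"] by (metis Un_subset_iff span_span top.extremum_uniqueI)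
  have finQ: "finite Q" using Q(3) by (rule independent_imp_finite)
  have "card Q = CARD('k)"
    using dim_eq_card[of Q UNIV] Q(3) spanQ by simp
  then obtain h :: "'k \<Rightarrow> real ^ 'k" where h: "bij_betw h UNIV Q"
    using finite_same_card_bij[of "UNIV :: 'k set" Q] finQ by auto
  define H where "H = (\<chi> i. h i)"
  have "rows H = Q" using h by (auto simp: rows_def row_def H_def bij_betw_def)
  then have "det H \<noteq> 0"
    using spanQ matrix_left_invertible_span_rows[of H] invertible_det_nz[of H] invertible_left_inverse[of H] by metis
  moreover have "det H \<in> \<int>"
  proof (rule det_in_Ints)
    fix i j
    have "h i \<in> Q" using h by (auto simp: bij_betw_def)
    then have "h i \<in> range real_vec" using Q(2) S(1) unfolding W_def by blast
    then show "H $ i $ j \<in> \<int>" by (auto simp: H_def)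
  qed
  ultimately have "1 \<le> \<bar>det H\<bar>" by (rule Ints_nonzero_abs_ge1[rotated])
  define N where "N = H ** transpose B"
  have N: "N $ i $ j = (B *v h i) $ j" for i j
    by (simp add: N_def H_def matrix_matrix_mult_def matrix_vector_mult_def transpose_def mult.commute)
  have "\<bar>det N\<bar> \<le> fact CARD('k) * \<epsilon>"
  proof (rule abs_det_le)
    fix p :: "'k \<Rightarrow> 'k" assume p: "p permutes UNIV"
    define I where "I = {i. h i \<in> S}"
    define G where "G i = \<bar>N $ i $ p i\<bar> * a (p i)" for i
    have hI: "bij_betw h I S"
      using h Q(1) by (auto simp: I_def bij_betw_def inj_on_def)
    have cardI: "card I = card S" using hI by (rule bij_betw_same_card)
    have "(\<Prod>i\<in>I. G i) = (\<Prod>v\<in>S. \<bar>(B *v v) $ p (inv_into I h v)\<bar> * a (p (inv_into I h v)))"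
      unfolding prod.reindex_bij_betw[OF hI, symmetric]
      using hI by (intro prod.cong) (auto simp: G_def N bij_betw_def)
    also have "\<dots> \<le> (\<Prod>i\<in>UNIV. a i)" by (rule bound)
    finally have GI: "(\<Prod>i\<in>I. G i) \<le> (\<Prod>i\<in>UNIV. a i)" .
    have "G i \<le> \<epsilon>" if "i \<in> - I" for i
    proof -
      have "h i \<in> W" using that h Q(2) by (auto simp: I_def bij_betw_def)
      then have "\<bar>(B *v h i) $ p i\<bar> \<le> \<epsilon> / a (p i)" by (auto simp: W_def)
      then show ?thesis using a[of "p i"] by (simp add: G_def N field_simps)
    qed
    moreover have G0: "0 \<le> G i" for i using a[of "p i"] by (simp add: G_def)
    ultimately have "(\<Prod>i\<in>-I. G i) \<le> (\<Prod>i\<in>-I. \<epsilon>)" by (intro prod_mono) auto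
    also have "\<dots> = \<epsilon> ^ (CARD('k) - card S)" by (simp add: Compl_eq_Diff_UNIV card_Diff_subset cardI)
    also have "\<dots> \<le> \<epsilon> ^ 1" using S(3) \<epsilon> by (intro power_decreasing) auto
    finally have "(\<Prod>i\<in>I. G i) * (\<Prod>i\<in>-I. G i) \<le> (\<Prod>i\<in>UNIV. a i) * \<epsilon>"
      using GI G0 a by (intro mult_mono prod_nonneg) (auto intro: less_imp_le)
    also have "(\<Prod>i\<in>I. G i) * (\<Prod>i\<in>-I. G i) = (\<Prod>i\<in>UNIV. G i)"
      by (subst prod.union_disjoint[symmetric]) (auto simp: Compl_partition)
    also have "\<dots> = (\<Prod>i\<in>UNIV. \<bar>N $ i $ p i\<bar>) * (\<Prod>i\<in>UNIV. a (p i))"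
      by (simp add: G_def prod.distrib)
    also have "(\<Prod>i\<in>UNIV. a (p i)) = (\<Prod>i\<in>UNIV. a i)"
      using prod.permute[OF p, of a] by (simp add: comp_def)
    finally show "(\<Prod>i\<in>UNIV. \<bar>N $ i $ p i\<bar>) \<le> \<epsilon>"
      using prod_pos[of UNIV a] a by (simp add: mult.commute)
  qed
  then have "\<bar>det N\<bar> \<le> 1 / 2" by (simp add: \<epsilon>_def)
  moreover have "\<bar>det N\<bar> = \<bar>det H\<bar> * \<bar>det B\<bar>" by (simp add: N_def det_mul abs_mult)
  moreover have "1 * 1 \<le> \<bar>det H\<bar> * \<bar>det B\<bar>" using \<open>1 \<le> \<bar>det H\<bar>\<close> detB by (intro mult_mono) auto
  ultimately show False by simp
qed

section \<open>Consecutive minimal points\<close>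

lemma lex_minimal_exists:
  fixes T D :: "'a \<Rightarrow> real"
  assumes fin: "\<And>R d. finite {v \<in> S. T v \<le> R \<and> D v \<le> d}"
    and "v0 \<in> S" "P (T v0)" and bdd: "\<And>x. P x \<Longrightarrow> x \<le> M"
  obtains v where "v \<in> S" "P (T v)" "\<And>w. w \<in> S \<Longrightarrow> P (T w) \<Longrightarrow> D v \<le> D w"
    "\<And>w. w \<in> S \<Longrightarrow> P (T w) \<Longrightarrow> D w = D v \<Longrightarrow> T v \<le> T w"
proof -
  define F where "F = {v \<in> S. P (T v) \<and> D v \<le> D v0}"
  have "F \<subseteq> {v \<in> S. T v \<le> M \<and> D v \<le> D v0}" using bdd by (auto simp: F_def)
  then have "finite F" using fin finite_subset by blast
  moreover have "v0 \<in> F" using assms by (simp add: F_def)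
  ultimately obtain v1 where v1: "v1 \<in> F" "\<And>w. w \<in> F \<Longrightarrow> D v1 \<le> D w"
    using ex_min_if_finite[of "D ` F"] by (metis empty_iff finite_imageI image_eqI image_iff image_is_empty linorder_not_less)
  define F' where "F' = {w \<in> F. D w = D v1}"
  have "finite F'" "v1 \<in> F'" using \<open>finite F\<close> v1 by (auto simp: F'_def)
  then obtain v where v: "v \<in> F'" "\<And>w. w \<in> F' \<Longrightarrow> T v \<le> T w"
    using ex_min_if_finite[of "T ` F'"] by (metis empty_iff finite_imageI image_eqI image_iff image_is_empty linorder_not_less)
  have Dv: "D v = D v1" and vF: "v \<in> F" using v by (auto simp: F'_def)
  show ?thesis
  proof (rule that)
    show "v \<in> S" "P (T v)" using vF by (auto simp: F_def)
    show "D v \<le> D w" if "w \<in> S" "P (T w)" for w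
      using that v1 Dv vF unfolding F_def by (cases "D w \<le> D v0") auto
    show "T v \<le> T w" if "w \<in> S" "P (T w)" "D w = D v" for w
      using that v(2)[of w] Dv vF by (auto simp: F_def F'_def)
  qed
qed

text \<open>
  Points \<open>v\<close> carry a height \<open>T v\<close> and a distance \<open>D v\<close>. A point is minimal if every point of
  smaller height has larger distance. The hypothesis \<open>small\<close> is a uniform approximation property
  with exponent \<open>\<alpha>\<close>. The conclusion selects the first minimal point \<open>u\<close> for which the product of
  its height and the height of its successor reaches \<open>K\<close>, and its predecessor \<open>p\<close>. The number \<open>R\<close>
  stands for any bound below which \<open>u\<close> has not been superseded, so that the case in which \<open>u\<close> has
  no successor needs no special treatment. There is no predecessor if \<open>u\<close> has the least possible
  height \<open>T0\<close>.
\<close>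

lemma consecutive_minimal_points:
  fixes T D :: "'a \<Rightarrow> real"
  assumes fin: "\<And>R d. finite {v \<in> S. T v \<le> R \<and> D v \<le> d}"
    and T0: "0 < T0" "\<And>v. v \<in> S \<Longrightarrow> T0 \<le> T v"
    and small: "\<And>R. T0 \<le> R \<Longrightarrow> \<exists>v\<in>S. T v \<le> R \<and> D v \<le> R powr - \<alpha>"
    and K: "T0\<^sup>2 \<le> K" and \<alpha>: "0 < \<alpha>"
  obtains u R where "u \<in> S" "T u \<le> R" "K \<le> T u * R" "D u \<le> R powr - \<alpha>"
    "T u = T0 \<or> (\<exists>p\<in>S. T p < T u \<and> D u < D p \<and> T p * T u \<le> K \<and> D p \<le> T u powr - \<alpha>)"
proof -
  define good where "good u R \<longleftrightarrow> u \<in> S \<and> T u \<le> R \<and> K \<le> T u * R \<and> (\<forall>w\<in>S. T w \<le> R \<longrightarrow> D u \<le> D w)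
      \<and> (\<forall>w\<in>S. T w < T u \<longrightarrow> D u < D w)" for u R
  define G where "G = {u. \<exists>R. good u R}"
  have R0: "T0 \<le> K / T0" using T0(1) K by (simp add: power2_eq_square field_simps)
  have ne: "\<exists>u\<in>G. T u \<le> K / T0"
  proof -
    obtain v0 where v0: "v0 \<in> S" "T v0 \<le> K / T0" "D v0 \<le> (K / T0) powr - \<alpha>" using small[OF R0] by blast
    obtain u where u: "u \<in> S" "T u \<le> K / T0" "\<And>w. w \<in> S \<Longrightarrow> T w \<le> K / T0 \<Longrightarrow> D u \<le> D w"
      "\<And>w. w \<in> S \<Longrightarrow> T w \<le> K / T0 \<Longrightarrow> D w = D u \<Longrightarrow> T u \<le> T w"
      by (rule lex_minimal_exists[of S T D v0 "\<lambda>x. x \<le> K / T0" "K / T0"]) (use fin v0 in auto)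
    have "K = T0 * (K / T0)" using T0(1) by simp
    also have "\<dots> \<le> T u * (K / T0)" using T0 u R0 by (intro mult_right_mono) auto
    finally have "good u (K / T0)" unfolding good_def using u by (smt (verit))
    then show ?thesis using u(2) by (auto simp: G_def)
  qed
  have approx: "D v \<le> R' powr - \<alpha>" if "T0 \<le> R'" "\<And>w. w \<in> S \<Longrightarrow> T w \<le> R' \<Longrightarrow> D v \<le> D w" for v R'
    using small[OF that(1)] that(2) by force
  define F where "F = {u \<in> G. T u \<le> K / T0}"
  have "F \<subseteq> {v \<in> S. T v \<le> K / T0 \<and> D v \<le> T0 powr - \<alpha>}"
  proof
    fix v assume v: "v \<in> F"
    then obtain R where R: "good v R" by (auto simp: F_def G_def)
    then have "T0 \<le> R" using T0(2)[of v] by (auto simp: good_def)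
    then have "D v \<le> R powr - \<alpha>" using approx R by (auto simp: good_def)
    also have "\<dots> \<le> T0 powr - \<alpha>" using \<open>T0 \<le> R\<close> T0(1) \<alpha> by (intro powr_mono2') auto
    finally show "v \<in> {v \<in> S. T v \<le> K / T0 \<and> D v \<le> T0 powr - \<alpha>}"
      using v R by (auto simp: F_def good_def)
  qed
  then have "finite F" using fin finite_subset by blast
  moreover have "F \<noteq> {}" using ne by (auto simp: F_def)
  ultimately obtain u where u: "u \<in> F" "\<And>w. w \<in> F \<Longrightarrow> T u \<le> T w"
    using ex_min_if_finite[of "T ` F"] by (metis finite_imageI image_eqI image_iff image_is_empty linorder_not_less)
  obtain R where "good u R" using u(1) by (auto simp: F_def G_def)
  then have R: "u \<in> S" "T u \<le> R" "K \<le> T u * R" "\<And>w. w \<in> S \<Longrightarrow> T w \<le> R \<Longrightarrow> D u \<le> D w"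
      "\<And>w. w \<in> S \<Longrightarrow> T w < T u \<Longrightarrow> D u < D w" by (auto simp: good_def)
  have "T0 \<le> R" using T0(2)[OF R(1)] R(2) by linarith
  then have DuR: "D u \<le> R powr - \<alpha>" using approx R(4) by blast
  show ?thesis
  proof (cases "T u = T0")
    case True
    then show ?thesis using that R DuR by blast
  next
    case False
    then have less: "T0 < T u" using T0(2)[OF R(1)] by simp
    obtain v0 where v0: "v0 \<in> S" "T v0 < T u" using small[of T0] less by force
    obtain p where p: "p \<in> S" "T p < T u" "\<And>w. w \<in> S \<Longrightarrow> T w < T u \<Longrightarrow> D p \<le> D w"
      "\<And>w. w \<in> S \<Longrightarrow> T w < T u \<Longrightarrow> D w = D p \<Longrightarrow> T p \<le> T w"
      by (rule lex_minimal_exists[of S T D v0 "\<lambda>x. x < T u" "T u"]) (use fin v0 in auto)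
    have strict: "D p < D w" if "w \<in> S" "T w < T p" for w
      using p(3)[OF that(1)] p(4)[OF that(1)] that p(2) by force
    \<comment> \<open>By the minimality of \<open>u\<close>, the point \<open>p\<close> does not belong to \<open>G\<close>.\<close>
    have step: "T p * R' < K \<and> D p \<le> R' powr - \<alpha>" if R': "T p \<le> R'" "R' < T u" for R'
    proof
      have min: "D p \<le> D w" if "w \<in> S" "T w \<le> R'" for w using p(3) that R' by force
      have "T0 \<le> R'" using T0(2)[OF p(1)] R' by linarith
      then show DpR: "D p \<le> R' powr - \<alpha>" using approx min by blast
      show "T p * R' < K"
      proof (rule ccontr)
        assume "\<not> T p * R' < K"
        then have K': "K \<le> T p * R'" by simp
        then have "good p R'" unfolding good_def using p R' min strict by auto
        then have "p \<in> F" using p(2) u(1) by (auto simp: F_def G_def)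
        then show False using u(2) p(2) by force
      qed
    qed
    have "eventually (\<lambda>R'. R' \<in> {T p<..<T u}) (at_left (T u))"
      using p(2) by (rule eventually_at_left_real)
    then have ev: "eventually (\<lambda>R'. T p * R' < K \<and> D p \<le> R' powr - \<alpha>) (at_left (T u))"
      by eventually_elim (use step in auto)
    have pos: "0 < T u" using less T0(1) by linarith
    have "T p * T u \<le> K"
    proof (rule tendsto_upperbound)
      show "((\<lambda>R'. T p * R') \<longlongrightarrow> T p * T u) (at_left (T u))" by (intro tendsto_intros)
      show "eventually (\<lambda>R'. T p * R' \<le> K) (at_left (T u))" using ev by eventually_elim simp
    qed simp
    moreover have "D p \<le> T u powr - \<alpha>"
    proof (rule tendsto_lowerbound)
      show "((\<lambda>R'. R' powr - \<alpha>) \<longlongrightarrow> T u powr - \<alpha>) (at_left (T u))"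
        using pos by (intro tendsto_intros) auto
      show "eventually (\<lambda>R'. D p \<le> R' powr - \<alpha>) (at_left (T u))" using ev by eventually_elim simp
    qed simp
    ultimately show ?thesis using that[OF R(1-3) DuR] p(1,2) R(5) by blast
  qed
qed

section \<open>The lattices of the homogeneous and of the transposed system\<close>

lemma big_op_UNIV_sum_type:
  "(\<Sum>c\<in>UNIV. f c) = (\<Sum>j\<in>UNIV. f (Inl j :: 'a::finite + 'b::finite)) + (\<Sum>i\<in>UNIV. f (Inr i))"
  "(\<Prod>c\<in>UNIV. g c) = (\<Prod>j\<in>UNIV. g (Inl j :: 'a::finite + 'b::finite)) * (\<Prod>i\<in>UNIV. g (Inr i))"
  for f :: "_ \<Rightarrow> 'c::comm_monoid_add" and g :: "_ \<Rightarrow> 'd::comm_monoid_mult"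
  using sum.Plus[of "UNIV :: 'a set" "UNIV :: 'b set" f] prod.Plus[of "UNIV :: 'a set" "UNIV :: 'b set" g]
  by (simp_all add: UNIV_Plus_UNIV comp_def)

text \<open>
  Integer vectors indexed by \<open>'m + 'n\<close> represent pairs \<open>(x, y)\<close>. The matrix \<open>primal_matrix \<Theta>\<close> maps
  \<open>(x, y)\<close> to \<open>(x, y - \<Theta> x)\<close>, and \<open>dual_matrix \<Theta>\<close> maps \<open>(u, v)\<close> to \<open>(u + \<Theta>\<^sup>T v, v)\<close>. The signs are
  such that the inner product of the images is \<open>x \<bullet> u + y \<bullet> v\<close>.
\<close>

definition primal_matrix :: "real ^ 'm::finite ^ 'n::finite \<Rightarrow> real ^ ('m + 'n) ^ ('m + 'n)" where
  "primal_matrix \<Theta> = (\<chi> r c. case r of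
      Inl j \<Rightarrow> (if c = Inl j then 1 else 0)
    | Inr i \<Rightarrow> (case c of Inl j \<Rightarrow> - \<Theta> $ i $ j | Inr k \<Rightarrow> if k = i then 1 else 0))"

definition dual_matrix :: "real ^ 'm::finite ^ 'n::finite \<Rightarrow> real ^ ('m + 'n) ^ ('m + 'n)" where
  "dual_matrix \<Theta> = (\<chi> r c. case r of
      Inl j \<Rightarrow> (case c of Inl k \<Rightarrow> if k = j then 1 else 0 | Inr i \<Rightarrow> \<Theta> $ i $ j)
    | Inr i \<Rightarrow> (if c = Inr i then 1 else 0))"

text \<open>
  The two components of a vector indexed by a sum type.
\<close>

definition left_part :: "'a ^ ('m::finite + 'n::finite) \<Rightarrow> 'a ^ 'm" where
  "left_part z = (\<chi> j. z $ Inl j)"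

definition right_part :: "'a ^ ('m::finite + 'n::finite) \<Rightarrow> 'a ^ 'n" where
  "right_part z = (\<chi> i. z $ Inr i)"

lemma part_nth [simp]: "left_part z $ j = z $ Inl j" "right_part z $ i = z $ Inr i"
  by (simp_all add: left_part_def right_part_def)

lemma parts_eq_0: "(left_part z, right_part z) = (0, 0) \<longleftrightarrow> z = 0"
  by (auto simp: vec_eq_iff split_sum_all)

lemma part_real_vec [simp]:
  "real_vec (left_part z) = left_part (real_vec z)" "real_vec (right_part z) = right_part (real_vec z)"
  by (simp_all add: vec_eq_iff)

lemma primal_matrix_mult:
  "(primal_matrix \<Theta> *v z) $ Inl j = z $ Inl j"
  "(primal_matrix \<Theta> *v z) $ Inr i = z $ Inr i - (\<Theta> *v left_part z) $ i"
  by (simp_all add: primal_matrix_def matrix_vector_mult_def big_op_UNIV_sum_type if_distrib[of "\<lambda>x. x * _"] sum_negf cong: if_cong)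

lemma dual_matrix_mult:
  "(dual_matrix \<Theta> *v w) $ Inl j = w $ Inl j + (transpose \<Theta> *v right_part w) $ j"
  "(dual_matrix \<Theta> *v w) $ Inr i = w $ Inr i"
  by (simp_all add: dual_matrix_def matrix_vector_mult_def transpose_def big_op_UNIV_sum_type if_distrib[of "\<lambda>x. x * _"] cong: if_cong)

lemma primal_dual_matrix: "transpose (primal_matrix \<Theta>) ** dual_matrix \<Theta> = mat 1"
proof -
  have "(transpose (primal_matrix \<Theta>) ** dual_matrix \<Theta>) $ r $ c = mat 1 $ r $ c" for r c
    by (cases r; cases c)
      (auto simp: primal_matrix_def dual_matrix_def matrix_matrix_mult_def transpose_def big_op_UNIV_sum_type mat_def
        if_distrib[of "\<lambda>x. x * _"] if_distrib[of "\<lambda>x. _ * x"] cong: if_cong)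
  then show ?thesis by (simp add: vec_eq_iff)
qed

lemma det_dual_matrix: "det (dual_matrix \<Theta>) = 1"
proof -
  have zero: "(\<Prod>r\<in>UNIV. dual_matrix \<Theta> $ r $ p r) = 0" if p: "p permutes UNIV" "p \<noteq> id" for p
  proof (rule ccontr)
    assume "(\<Prod>r\<in>UNIV. dual_matrix \<Theta> $ r $ p r) \<noteq> 0"
    then have nz: "dual_matrix \<Theta> $ r $ p r \<noteq> 0" for r by (simp add: prod_zero_iff)
    \<comment> \<open>The matrix is unitriangular, so only the identity contributes to the determinant.\<close>
    have r: "p (Inr i) = Inr i" for i using nz[of "Inr i"] by (auto simp: dual_matrix_def split: if_splits)
    have "p (Inl j) = Inl j" for j
    proof (cases "p (Inl j)")
      case (Inl k)
      then show ?thesis using nz[of "Inl j"] by (auto simp: dual_matrix_def split: if_splits)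
    next
      case (Inr i)
      then have "p (Inl j) = p (Inr i)" using r by simp
      then show ?thesis using permutes_inj[OF p(1)] by (metis injD sum.distinct(1))
    qed
    then have "p x = x" for x using r by (cases x) auto
    then show False using p(2) by (auto simp: fun_eq_iff)
  qed
  have "det (dual_matrix \<Theta>) = (\<Sum>p\<in>{id}. of_int (sign p) * (\<Prod>r\<in>UNIV. dual_matrix \<Theta> $ r $ p r))"
    unfolding det_def by (rule sum.mono_neutral_right) (auto simp: zero permutes_id)
  also have "\<dots> = 1"
    by (simp add: sign_id big_op_UNIV_sum_type dual_matrix_def)
  finally show ?thesis .
qed

section \<open>Weighted norms and exponents\<close>

lemma weighted_norm_le_iff:
  assumes w: "\<And>i. 0 < w $ i" and c: "0 < c"
  shows "weighted_norm w x \<le> c \<longleftrightarrow> (\<forall>i. \<bar>x $ i\<bar> \<le> c powr (w $ i))"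
proof -
  have "\<bar>x $ i\<bar> powr (1 / w $ i) \<le> c \<longleftrightarrow> \<bar>x $ i\<bar> \<le> c powr (w $ i)" for i
  proof
    assume "\<bar>x $ i\<bar> powr (1 / w $ i) \<le> c"
    then have "(\<bar>x $ i\<bar> powr (1 / w $ i)) powr (w $ i) \<le> c powr (w $ i)"
      using w[of i] by (intro powr_mono2) auto
    then show "\<bar>x $ i\<bar> \<le> c powr (w $ i)" using w[of i] by (simp add: powr_powr)
  next
    assume "\<bar>x $ i\<bar> \<le> c powr (w $ i)"
    then have "\<bar>x $ i\<bar> powr (1 / w $ i) \<le> (c powr (w $ i)) powr (1 / w $ i)"
      using w[of i] by (intro powr_mono2) auto
    then show "\<bar>x $ i\<bar> powr (1 / w $ i) \<le> c" using w[of i] c by (simp add: powr_powr)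
  qed
  then show ?thesis unfolding weighted_norm_def by (subst Max_le_iff) auto
qed

lemma weighted_norm_nonneg: "0 \<le> weighted_norm w x"
proof -
  fix i
  have "0 \<le> \<bar>x $ i\<bar> powr (1 / w $ i)" by simp
  also have "\<dots> \<le> weighted_norm w x" unfolding weighted_norm_def by (intro Max_ge) auto
  finally show ?thesis .
qed

lemma abs_le_weighted_norm:
  assumes w: "\<And>i. 0 < w $ i" and "weighted_norm w x \<le> c"
  shows "\<bar>x $ i\<bar> \<le> c powr (w $ i)"
proof -
  have "\<bar>x $ i\<bar> powr (1 / w $ i) \<le> weighted_norm w x" unfolding weighted_norm_def by (intro Max_ge) auto
  then have "(\<bar>x $ i\<bar> powr (1 / w $ i)) powr (w $ i) \<le> c powr (w $ i)"
    using w[of i] assms(2) by (intro powr_mono2) auto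
  then show ?thesis using w[of i] by (simp add: powr_powr)
qed

lemma weighted_norm_mono:
  assumes w: "\<And>i. 0 < w $ i" and "\<And>i. \<bar>x $ i\<bar> \<le> \<bar>y $ i\<bar>"
  shows "weighted_norm w x \<le> weighted_norm w y"
  unfolding weighted_norm_def
proof (subst Max_le_iff, simp, simp, intro ballI)
  fix a assume "a \<in> range (\<lambda>i. \<bar>x $ i\<bar> powr (1 / w $ i))"
  then obtain i where "a = \<bar>x $ i\<bar> powr (1 / w $ i)" by blast
  also have "\<dots> \<le> \<bar>y $ i\<bar> powr (1 / w $ i)" using assms(2) w[of i] by (intro powr_mono2) (auto simp: less_imp_le)
  also have "\<dots> \<le> Max (range (\<lambda>i. \<bar>y $ i\<bar> powr (1 / w $ i)))" by (intro Max_ge) auto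
  finally show "a \<le> Max (range (\<lambda>i. \<bar>y $ i\<bar> powr (1 / w $ i)))" .
qed

lemma weights_bounds:
  assumes "weights w"
  shows "0 < w $ i" "0 < last_weight w" "last_weight w \<le> w $ i" "last_weight w \<le> 1" "(\<Sum>i\<in>UNIV. w $ i) = 1"
proof -
  show pos: "0 < w $ i" and sum: "(\<Sum>i\<in>UNIV. w $ i) = 1" and "0 < last_weight w" for i
    using assms by (auto simp: weights_def last_weight_def)
  show "last_weight w \<le> w $ i" for i
    using assms by (auto simp: weights_def last_weight_def)
  have "last_weight w \<le> (\<Sum>i\<in>UNIV. w $ i)" unfolding last_weight_def
    using pos by (intro member_le_sum) (auto intro: less_imp_le)
  then show "last_weight w \<le> 1" using sum by simp
qed

text \<open>
  The half-sides of the box \<open>\<bar>x\<^sub>j\<bar> \<le> t\<^bsup>\<sigma>\<^sub>j\<^esup>\<close>, \<open>\<bar>(y - \<Theta> x)\<^sub>i\<bar> \<le> t\<^bsup>- \<gamma> \<rho>\<^sub>i\<^esup>\<close> that describes the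
  homogeneous system with exponent \<open>\<gamma>\<close>.
\<close>

definition box_side :: "real ^ 'm \<Rightarrow> real ^ 'n \<Rightarrow> real \<Rightarrow> real \<Rightarrow> 'm::finite + 'n::finite \<Rightarrow> real" where
  "box_side \<sigma> \<rho> \<gamma> t k = (case k of Inl j \<Rightarrow> t powr (\<sigma> $ j) | Inr i \<Rightarrow> t powr (- \<gamma> * \<rho> $ i))"

lemma box_side_pos: "0 < t \<Longrightarrow> 0 < box_side \<sigma> \<rho> \<gamma> t k"
  by (auto simp: box_side_def split: sum.split)

lemma prod_box_side:
  assumes "weights \<sigma>" "weights \<rho>" "0 < t"
  shows "(\<Prod>k\<in>UNIV. box_side \<sigma> \<rho> \<gamma> t k) = t powr (1 - \<gamma>)"
proof -
  have "(\<Prod>k\<in>UNIV. box_side \<sigma> \<rho> \<gamma> t k) = t powr (\<Sum>j\<in>UNIV. \<sigma> $ j) * t powr (\<Sum>i\<in>UNIV. - \<gamma> * \<rho> $ i)"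
    using assms by (simp add: big_op_UNIV_sum_type box_side_def powr_sum)
  also have "(\<Sum>i\<in>UNIV. - \<gamma> * \<rho> $ i) = - \<gamma>"
    by (metis weights_bounds(5)[OF assms(2)] mult.right_neutral sum_distrib_left)
  finally show ?thesis using weights_bounds(5)[OF assms(1)] powr_add[of t 1 "- \<gamma>"] by simp
qed

lemma ereal_le_if_reals_le:
  assumes "\<And>x. x < \<gamma> \<Longrightarrow> ereal x \<le> S"
  shows "ereal \<gamma> \<le> S"
proof (rule ccontr)
  assume "\<not> ereal \<gamma> \<le> S"
  then have "S < ereal \<gamma>" by simp
  then obtain x where "S < ereal x" "ereal x < ereal \<gamma>" using ereal_dense2 by blast
  then show False using assms[of x] by auto
qed

lemma le_powr_inverse_powr:
  fixes c a b :: real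
  assumes "1 \<le> c" "0 < a" "a \<le> b"
  shows "c \<le> (c powr (1 / a)) powr b"
proof -
  have "c powr 1 \<le> c powr (b / a)" using assms by (intro powr_mono) (auto simp: field_simps)
  then show ?thesis using assms by (simp add: powr_powr)
qed

text \<open>
  A constant factor in the inequalities of the homogeneous system does not affect the exponent.
\<close>

lemma uniform_exponent_ge:
  fixes \<Theta> :: "real ^ 'm::{finite,wellorder} ^ 'n::{finite,wellorder}"
  assumes w: "weights \<sigma>" "weights \<rho>" and c: "1 \<le> c"
    and ev: "\<forall>\<^sub>F t in at_top. \<exists>z :: int ^ ('m + 'n). z \<noteq> 0 \<and>
      (\<forall>k. \<bar>(primal_matrix \<Theta> *v real_vec z) $ k\<bar> \<le> c * box_side \<sigma> \<rho> \<gamma> t k)"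
  shows "ereal \<gamma> \<le> uniform_exponent \<sigma> \<rho> \<Theta>"
proof (rule ereal_le_if_reals_le)
  fix \<gamma>' assume less: "\<gamma>' < \<gamma>"
  define c1 where "c1 = c powr (1 / last_weight \<sigma>)"
  define c2 where "c2 = c powr (1 / last_weight \<rho>)"
  note s = weights_bounds[OF w(1)] and r = weights_bounds[OF w(2)]
  have c12: "0 < c1" "0 < c2" using c by (auto simp: c1_def c2_def)
  have "filterlim (\<lambda>t. t / c1) at_top at_top"
    using c12(1) by real_asymp
  then have ev': "\<forall>\<^sub>F t in at_top. \<exists>z :: int ^ ('m + 'n). z \<noteq> 0 \<and>
      (\<forall>k. \<bar>(primal_matrix \<Theta> *v real_vec z) $ k\<bar> \<le> c * box_side \<sigma> \<rho> \<gamma> (t / c1) k)"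
    using ev by (rule eventually_compose_filterlim[rotated])
  have "filterlim (\<lambda>t::real. t powr (\<gamma> - \<gamma>')) at_top at_top" using less by real_asymp
  then have ev2: "\<forall>\<^sub>F t in at_top. c2 * c1 powr \<gamma> \<le> t powr (\<gamma> - \<gamma>')" by (simp add: filterlim_at_top)
  have "\<forall>\<^sub>F t in at_top. \<exists>(x :: int ^ 'm::_) (y :: int ^ 'n::_). (x, y) \<noteq> (0, 0) \<and>
       weighted_norm \<sigma> (real_vec x) \<le> t \<and> weighted_norm \<rho> (\<Theta> *v real_vec x - real_vec y) \<le> t powr (- \<gamma>')"
    using ev' ev2 eventually_gt_at_top[of 0]
  proof eventually_elim
    case (elim t)
    then obtain z :: "int ^ ('m + 'n)" where z: "z \<noteq> 0"
      "\<And>k. \<bar>(primal_matrix \<Theta> *v real_vec z) $ k\<bar> \<le> c * box_side \<sigma> \<rho> \<gamma> (t / c1) k" by blast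
    have "\<bar>real_vec (left_part z) $ j\<bar> \<le> t powr (\<sigma> $ j)" for j
    proof -
      have "\<bar>real_vec (left_part z) $ j\<bar> \<le> c * (t / c1) powr (\<sigma> $ j)"
        using z(2)[of "Inl j"] by (simp add: primal_matrix_mult box_side_def)
      also have "\<dots> \<le> c1 powr (\<sigma> $ j) * (t / c1) powr (\<sigma> $ j)"
        unfolding c1_def using s c by (intro mult_right_mono le_powr_inverse_powr) auto
      also have "\<dots> = t powr (\<sigma> $ j)" using c12 elim by (simp add: powr_divide)
      finally show ?thesis .
    qed
    moreover have "\<bar>(\<Theta> *v real_vec (left_part z) - real_vec (right_part z)) $ i\<bar> \<le> (t powr - \<gamma>') powr (\<rho> $ i)" for i
    proof -
      have "c2 * (t / c1) powr (- \<gamma>) = c2 * c1 powr \<gamma> * t powr (- \<gamma>)"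
        using c12 elim by (simp add: powr_divide powr_minus field_simps)
      also have "\<dots> \<le> t powr (\<gamma> - \<gamma>') * t powr (- \<gamma>)" using elim by (intro mult_right_mono) auto
      also have "\<dots> = t powr (- \<gamma>')" by (simp add: powr_add[symmetric])
      finally have le: "c2 * (t / c1) powr (- \<gamma>) \<le> t powr (- \<gamma>')" .
      have "\<bar>(\<Theta> *v real_vec (left_part z) - real_vec (right_part z)) $ i\<bar> \<le> c * (t / c1) powr (- \<gamma> * \<rho> $ i)"
        using z(2)[of "Inr i"] by (simp add: primal_matrix_mult box_side_def abs_minus_commute)
      also have "\<dots> \<le> c2 powr (\<rho> $ i) * (t / c1) powr (- \<gamma> * \<rho> $ i)"
        unfolding c2_def using r c by (intro mult_right_mono le_powr_inverse_powr) auto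
      also have "\<dots> = (c2 * (t / c1) powr (- \<gamma>)) powr (\<rho> $ i)"
        using c12 by (simp add: powr_mult powr_powr)
      also have "\<dots> \<le> (t powr (- \<gamma>')) powr (\<rho> $ i)" using le r c12 by (intro powr_mono2) (auto intro: less_imp_le)
      finally show ?thesis .
    qed
    ultimately have "weighted_norm \<sigma> (real_vec (left_part z)) \<le> t"
      "weighted_norm \<rho> (\<Theta> *v real_vec (left_part z) - real_vec (right_part z)) \<le> t powr (- \<gamma>')"
      using elim s(1) r(1) by (simp_all add: weighted_norm_le_iff del: part_real_vec vector_minus_component)
    then show ?case using z(1) parts_eq_0[of z] by blast
  qed
  then show "ereal \<gamma>' \<le> uniform_exponent \<sigma> \<rho> \<Theta>"
    unfolding uniform_exponent_def by (intro Sup_upper) blast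
qed

text \<open>
  Dirichlet's theorem.
\<close>

lemma uniform_exponent_ge_1:
  fixes \<Theta> :: "real ^ 'm::{finite,wellorder} ^ 'n::{finite,wellorder}"
  assumes w: "weights \<sigma>" "weights \<rho>"
  shows "1 \<le> uniform_exponent \<sigma> \<rho> \<Theta>"
proof -
  have "ereal 1 \<le> uniform_exponent \<sigma> \<rho> \<Theta>"
  proof (rule uniform_exponent_ge[OF w box_const_ge_1])
    show "\<forall>\<^sub>F t in at_top. \<exists>z :: int ^ ('m + 'n). z \<noteq> 0 \<and>
      (\<forall>k. \<bar>(primal_matrix \<Theta> *v real_vec z) $ k\<bar> \<le> box_const CARD('m + 'n) * box_side \<sigma> \<rho> 1 t k)"
      using eventually_gt_at_top[of 0]
    proof eventually_elim
      case (elim t)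
      show ?case
        by (rule lattice_point_in_box[OF primal_dual_matrix, where S = "{}"])
          (use elim w in \<open>auto simp: det_dual_matrix box_side_pos prod_box_side independent_empty\<close>)
    qed
  qed
  then show ?thesis by (simp add: one_ereal_def)
qed

lemma finite_int_box: "finite {w :: int ^ 'k::finite. \<forall>i. \<bar>real_of_int (w $ i)\<bar> \<le> M i}"
proof (rule finite_subset)
  show "finite ((\<lambda>f. \<chi> i. f i) ` (Pi\<^sub>E UNIV (\<lambda>i :: 'k. {- \<lceil>M i\<rceil>..\<lceil>M i\<rceil>})))"
    by (intro finite_imageI finite_PiE) auto
  show "{w :: int ^ 'k. \<forall>i. \<bar>real_of_int (w $ i)\<bar> \<le> M i} \<subseteq> (\<lambda>f. \<chi> i. f i) ` (Pi\<^sub>E UNIV (\<lambda>i. {- \<lceil>M i\<rceil>..\<lceil>M i\<rceil>}))"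
  proof
    fix w :: "int ^ 'k" assume w: "w \<in> {w. \<forall>i. \<bar>real_of_int (w $ i)\<bar> \<le> M i}"
    have "- \<lceil>M i\<rceil> \<le> w $ i \<and> w $ i \<le> \<lceil>M i\<rceil>" for i
    proof -
      have "\<bar>real_of_int (w $ i)\<bar> \<le> M i" using w by simp
      then show ?thesis using le_of_int_ceiling[of "M i"] by linarith
    qed
    then show "w \<in> (\<lambda>f. \<chi> i. f i) ` (Pi\<^sub>E UNIV (\<lambda>i. {- \<lceil>M i\<rceil>..\<lceil>M i\<rceil>}))"
      by (intro image_eqI[of _ _ "\<lambda>i. w $ i"]) (auto simp: vec_eq_iff)
  qed
qed

section \<open>Transference of uniform exponents\<close>

lemma lattice_point_in_box_1:
  fixes A B :: "real ^ 'k ^ 'k" and a :: "'k::finite \<Rightarrow> real" and w :: "int ^ 'k"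
  assumes "transpose A ** B = mat 1" "1 \<le> \<bar>det B\<bar>" "\<And>i. 0 < a i" "2 \<le> CARD('k)" "w \<noteq> 0"
    and "\<And>k. \<bar>(B *v real_vec w) $ k\<bar> * a k \<le> (\<Prod>i\<in>UNIV. a i)"
  shows "\<exists>z :: int ^ 'k. z \<noteq> 0 \<and> (\<forall>i. \<bar>(A *v real_vec z) $ i\<bar> \<le> box_const CARD('k) * a i)"
  by (rule lattice_point_in_box[of A B a "{real_vec w}"]) (use assms in \<open>auto simp: dependent_single\<close>)

lemma lattice_point_in_box_2:
  fixes A B :: "real ^ 'k ^ 'k" and a :: "'k::finite \<Rightarrow> real" and p u :: "int ^ 'k"
  assumes "transpose A ** B = mat 1" "1 \<le> \<bar>det B\<bar>" "\<And>i. 0 < a i" "3 \<le> CARD('k)"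
    and "u \<noteq> 0" and indep: "\<And>c. real_vec p \<noteq> c *\<^sub>R real_vec u"
    and bound: "\<And>k l. (\<bar>(B *v real_vec p) $ k\<bar> * a k) * (\<bar>(B *v real_vec u) $ l\<bar> * a l) \<le> (\<Prod>i\<in>UNIV. a i)"
  shows "\<exists>z :: int ^ 'k. z \<noteq> 0 \<and> (\<forall>i. \<bar>(A *v real_vec z) $ i\<bar> \<le> box_const CARD('k) * a i)"
proof (rule lattice_point_in_box[of A B a "{real_vec p, real_vec u}"])
  have ne: "real_vec p \<noteq> real_vec u" using indep[of 1] by auto
  show "independent {real_vec p, real_vec u}"
    using indep assms(5) ne by (auto simp: independent_insert span_singleton)
  show "card {real_vec p, real_vec u} < CARD('k)" using assms(4) ne by simp
  show "(\<Prod>v\<in>{real_vec p, real_vec u}. \<bar>(B *v v) $ \<phi> v\<bar> * a (\<phi> v)) \<le> (\<Prod>i\<in>UNIV. a i)" for \<phi>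
    using bound ne by simp
qed (use assms in auto)

text \<open>
  The height \<open>|v|\<^sub>\<rho>\<close> of a dual point \<open>w = (u, v)\<close>, and the distance \<open>|\<Theta>\<^sup>T v + u|\<^sub>\<sigma>\<close> that measures
  its quality as an approximation to the transposed system.
\<close>

definition dual_height :: "real ^ 'n::finite \<Rightarrow> int ^ ('m::finite + 'n) \<Rightarrow> real" where
  "dual_height \<rho> w = weighted_norm \<rho> (right_part (real_vec w))"

definition dual_dist :: "real ^ 'm::finite \<Rightarrow> real ^ 'm ^ 'n::finite \<Rightarrow> int ^ ('m + 'n) \<Rightarrow> real" where
  "dual_dist \<sigma> \<Theta> w = weighted_norm \<sigma> (left_part (dual_matrix \<Theta> *v real_vec w))"

lemma finite_dual_points:
  fixes \<Theta> :: "real ^ 'm::{finite,wellorder} ^ 'n::{finite,wellorder}"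
  assumes w: "weights \<sigma>" "weights \<rho>"
  shows "finite {w. dual_height \<rho> w \<le> R \<and> dual_dist \<sigma> \<Theta> w \<le> d}"
proof -
  define M where "M k = (case k of Inl j \<Rightarrow> d powr (\<sigma> $ j) + (\<Sum>i\<in>UNIV. \<bar>\<Theta> $ i $ j\<bar> * R powr (\<rho> $ i))
    | Inr i \<Rightarrow> R powr (\<rho> $ i))" for k :: "'m + 'n"
  have "\<bar>real_of_int (w $ k)\<bar> \<le> M k" if w': "dual_height \<rho> w \<le> R" "dual_dist \<sigma> \<Theta> w \<le> d" for w k
  proof -
    have R: "\<bar>real_of_int (w $ Inr i)\<bar> \<le> R powr (\<rho> $ i)" for i
      using abs_le_weighted_norm[OF weights_bounds(1)[OF w(2)] w'(1)[unfolded dual_height_def], of i] by simp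
    show ?thesis
    proof (cases k)
      case (Inr i)
      then show ?thesis using R by (simp add: M_def)
    next
      case (Inl j)
      let ?s = "(transpose \<Theta> *v right_part (real_vec w)) $ j"
      have "\<bar>real_of_int (w $ Inl j) + ?s\<bar> \<le> d powr (\<sigma> $ j)"
        using abs_le_weighted_norm[OF weights_bounds(1)[OF w(1)] w'(2)[unfolded dual_dist_def], of j]
        by (simp add: dual_matrix_mult)
      moreover have "\<bar>?s\<bar> \<le> (\<Sum>i\<in>UNIV. \<bar>\<Theta> $ i $ j * real_of_int (w $ Inr i)\<bar>)"
        by (simp add: matrix_vector_mult_def transpose_def)
      moreover have "\<dots> \<le> (\<Sum>i\<in>UNIV. \<bar>\<Theta> $ i $ j\<bar> * R powr (\<rho> $ i))"
        unfolding abs_mult using R by (intro sum_mono mult_left_mono) auto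
      ultimately show ?thesis by (simp add: Inl M_def)
    qed
  qed
  then have "{w. dual_height \<rho> w \<le> R \<and> dual_dist \<sigma> \<Theta> w \<le> d} \<subseteq> {w. \<forall>k. \<bar>real_of_int (w $ k)\<bar> \<le> M k}" by blast
  then show ?thesis using finite_int_box finite_subset by blast
qed

lemma dual_points_not_proportional:
  assumes w: "\<And>j. 0 < \<sigma> $ j" "\<And>i. 0 < \<rho> $ i"
    and "dual_height \<rho> p < dual_height \<rho> u" "dual_dist \<sigma> \<Theta> u < dual_dist \<sigma> \<Theta> p"
  shows "real_vec p \<noteq> c *\<^sub>R real_vec u"
proof
  assume eq: "real_vec p = c *\<^sub>R real_vec u"
  \<comment> \<open>Height and distance both increase with the absolute value of a scalar factor.\<close>
  show False
  proof (cases "1 \<le> \<bar>c\<bar>")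
    case True
    have "dual_height \<rho> u \<le> dual_height \<rho> p"
      unfolding dual_height_def eq using True
      by (intro weighted_norm_mono w) (auto simp: abs_mult mult_le_cancel_right1)
    then show False using assms by simp
  next
    case False
    have "dual_matrix \<Theta> *v real_vec p = c *\<^sub>R (dual_matrix \<Theta> *v real_vec u)"
      unfolding eq by (rule linear_scale) (rule matrix_vector_mul_linear)
    then have "dual_dist \<sigma> \<Theta> p \<le> dual_dist \<sigma> \<Theta> u"
      unfolding dual_dist_def using False
      by (intro weighted_norm_mono w) (auto simp: abs_mult mult_le_cancel_right1 mult_le_cancel_right2)
    then show False using assms by simp
  qed
qed

text \<open>
  The bounds needed for two consecutive minimal points in normalised form: \<open>x \<le> y\<close> are their
  heights divided by \<open>t\<^bsup>\<gamma>\<^esup>\<close>, \<open>\<delta> \<ge> \<delta>'\<close> are their distances multiplied by \<open>t\<close>, and \<open>N = t\<^bsup>1 - \<gamma>\<^esup>\<close> is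
  the product of the half-sides of the box.
\<close>

lemma two_point_inequalities:
  fixes r s \<alpha> \<kappa> N x y \<delta> \<delta>' :: real
  assumes r: "0 < r" and s: "0 < s" and \<alpha>: "0 < \<alpha>" and \<kappa>: "0 < \<kappa>" "\<kappa> powr r \<le> N" "\<kappa> powr (\<alpha> * s) \<le> N"
    and x: "0 < x" "x \<le> y" "x * y \<le> \<kappa>" "\<kappa> < y" "y < 1"
    and \<delta>: "0 \<le> \<delta>'" "\<delta>' \<le> \<delta>" "\<delta> \<le> (\<kappa> / y) powr \<alpha>" "\<delta>' \<le> y powr \<alpha>"
  shows "\<delta> \<le> 1" "x powr r * y powr r \<le> N" "\<delta> powr s * y powr r \<le> N" "\<delta>' powr s * x powr r \<le> N"
    "\<delta> powr s * \<delta>' powr s \<le> N"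
proof -
  have ds: "\<delta> powr s \<le> (\<kappa> / y) powr (\<alpha> * s)" "\<delta>' powr s \<le> y powr (\<alpha> * s)"
    using powr_mono2[of s \<delta> "(\<kappa> / y) powr \<alpha>"] powr_mono2[of s \<delta>' "y powr \<alpha>"] \<delta> s by (simp_all add: powr_powr)
  have "(\<kappa> / y) powr \<alpha> \<le> 1 powr \<alpha>" using \<kappa> x \<alpha> by (intro powr_mono2) auto
  then show "\<delta> \<le> 1" using \<delta> by simp
  have "x powr r * y powr r = (x * y) powr r" using x by (simp add: powr_mult)
  also have "\<dots> \<le> \<kappa> powr r" using x r by (intro powr_mono2) auto
  finally show "x powr r * y powr r \<le> N" using \<kappa> by simp
  have "\<delta> powr s * y powr r \<le> (\<kappa> / y) powr (\<alpha> * s) * y powr r"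
    using ds by (intro mult_right_mono) auto
  also have "\<dots> = \<kappa> powr (\<alpha> * s) * y powr (r - \<alpha> * s)"
    using \<kappa> x by (simp add: powr_divide powr_diff)
  also have "\<dots> \<le> N"
  proof (cases "\<alpha> * s \<le> r")
    case True
    have "y powr (r - \<alpha> * s) \<le> 1" using True x by (intro powr_le1) auto
    then have "\<kappa> powr (\<alpha> * s) * y powr (r - \<alpha> * s) \<le> \<kappa> powr (\<alpha> * s)" by (intro mult_left_le) auto
    then show ?thesis using \<kappa> by linarith
  next
    case False
    have "y powr (r - \<alpha> * s) \<le> \<kappa> powr (r - \<alpha> * s)" using False \<kappa> x by (intro powr_mono2') auto
    then have "\<kappa> powr (\<alpha> * s) * y powr (r - \<alpha> * s) \<le> \<kappa> powr (\<alpha> * s) * \<kappa> powr (r - \<alpha> * s)" by (intro mult_left_mono) auto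
    then show ?thesis using \<kappa> by (simp add: powr_add[symmetric])
  qed
  finally show *: "\<delta> powr s * y powr r \<le> N" .
  have "\<delta>' powr s * x powr r \<le> \<delta> powr s * y powr r"
    using \<delta> x r s by (intro mult_mono powr_mono2) auto
  then show "\<delta>' powr s * x powr r \<le> N" using * by simp
  have "\<delta> powr s * \<delta>' powr s \<le> (\<kappa> / y) powr (\<alpha> * s) * y powr (\<alpha> * s)"
    using ds by (intro mult_mono) auto
  also have "\<dots> = \<kappa> powr (\<alpha> * s)" using \<kappa> x by (simp add: powr_divide)
  finally show "\<delta> powr s * \<delta>' powr s \<le> N" using \<kappa> by simp
qed

text \<open>
  The threshold for the minimal points is \<open>K = t\<^bsup>\<gamma> + 1 / \<alpha>\<^esup> = \<kappa> B\<^sup>2\<close> with \<open>B = t\<^bsup>\<gamma>\<^esup>\<close> and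
  \<open>\<kappa> = t\<^bsup>1 / \<alpha> - \<gamma>\<^esup>\<close>. If the height of \<open>u\<close> is at most \<open>\<kappa> B\<close>, then \<open>u\<close> is superseded only beyond
  \<open>B\<close> and alone forces a lattice point into a multiple of the box; if the height of \<open>u\<close> is at
  least \<open>B\<close>, then the same holds for its predecessor \<open>p\<close>. In the remaining case \<open>p\<close> and \<open>u\<close> are
  used together, which is possible only in dimension at least \<open>3\<close>. The hypotheses \<open>h1\<close> and \<open>h2\<close>
  say that \<open>\<kappa>\<^bsup>r\<^esup>\<close> and \<open>\<kappa>\<^bsup>\<alpha> s\<^esup>\<close> are at most the product \<open>N\<close> of the half-sides of the box, where \<open>r\<close>
  and \<open>s\<close> are the smallest weights.
\<close>

lemma uniform_transference_at:
  fixes \<Theta> :: "real ^ 'm::{finite,wellorder} ^ 'n::{finite,wellorder}"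
  assumes w: "weights \<sigma>" "weights \<rho>" and card: "3 \<le> CARD('m + 'n)"
    and \<gamma>: "1 \<le> \<gamma>" and \<alpha>: "0 < \<alpha>"
    and h1: "\<gamma> - 1 \<le> last_weight \<rho> * (\<gamma> - 1 / \<alpha>)"
    and h2: "\<gamma> - 1 \<le> last_weight \<sigma> * (\<alpha> * \<gamma> - 1)"
    and T0: "0 < T0"
    and dual: "\<And>R. T0 \<le> R \<Longrightarrow> \<exists>w :: int ^ ('m + 'n). w \<noteq> 0 \<and> dual_height \<rho> w \<le> R \<and> dual_dist \<sigma> \<Theta> w \<le> R powr - \<alpha>"
    and t: "1 \<le> t" "T0 \<le> t powr (1 / \<alpha>)" "T0 \<le> t powr \<gamma>"
  shows "\<exists>z :: int ^ ('m + 'n). z \<noteq> 0 \<and>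
    (\<forall>k. \<bar>(primal_matrix \<Theta> *v real_vec z) $ k\<bar> \<le> box_const CARD('m + 'n) * box_side \<sigma> \<rho> \<gamma> t k)"
    (is ?goal)
proof -
  define s r where "s = last_weight \<sigma>" and "r = last_weight \<rho>"
  have s: "0 < s" "\<And>j. s \<le> \<sigma> $ j" and r: "0 < r" "\<And>i. r \<le> \<rho> $ i"
    using weights_bounds[OF w(1)] weights_bounds[OF w(2)] by (auto simp: s_def r_def)
  define T where "T w = max T0 (dual_height \<rho> w)" for w :: "int ^ ('m + 'n)"
  define D where "D = (dual_dist \<sigma> \<Theta> :: int ^ ('m + 'n) \<Rightarrow> real)"
  define K where "K = t powr (\<gamma> + 1 / \<alpha>)"
  define B where "B = t powr \<gamma>"
  define \<kappa> where "\<kappa> = t powr (1 / \<alpha> - \<gamma>)"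
  define N where "N = t powr (1 - \<gamma>)"
  have tpos: "0 < t" and B: "0 < B" and \<kappa>: "0 < \<kappa>" using t by (auto simp: B_def \<kappa>_def)
  have \<kappa>B: "\<kappa> * B = t powr (1 / \<alpha>)" and \<kappa>BB: "\<kappa> * B * B = K"
    by (simp_all add: \<kappa>_def B_def K_def powr_add[symmetric] add.commute)
  have N: "N \<le> 1" "(\<Prod>k\<in>UNIV. box_side \<sigma> \<rho> \<gamma> t k) = N"
    using powr_mono[of "1 - \<gamma>" 0 t] t \<gamma> tpos w by (auto simp: N_def prod_box_side)
  have "(1 / \<alpha> - \<gamma>) * r \<le> 1 - \<gamma>" using h1 by (simp add: r_def algebra_simps)
  then have \<kappa>r: "\<kappa> powr r \<le> N"
    unfolding \<kappa>_def N_def powr_powr using t by (intro powr_mono) auto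
  have "(1 / \<alpha> - \<gamma>) * (\<alpha> * s) = s * (1 - \<alpha> * \<gamma>)" using \<alpha> by (simp add: field_simps)
  also have "\<dots> \<le> 1 - \<gamma>" using h2 by (simp add: s_def algebra_simps)
  finally have \<kappa>s: "\<kappa> powr (\<alpha> * s) \<le> N"
    unfolding \<kappa>_def N_def powr_powr using t by (intro powr_mono) auto
  have "0 \<le> r * (\<gamma> - 1 / \<alpha>)" using h1 \<gamma> by (simp add: r_def)
  then have "0 \<le> \<gamma> - 1 / \<alpha>" using r(1) by (simp add: zero_le_mult_iff)
  then have \<kappa>1: "\<kappa> \<le> 1" using powr_mono[of "1 / \<alpha> - \<gamma>" 0 t] t by (simp add: \<kappa>_def)
  have D0: "0 \<le> D w" for w unfolding D_def dual_dist_def by (rule weighted_norm_nonneg)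
  have Tpos: "0 < T w" for w using T0 by (simp add: T_def)
  have dist: "D w * t \<le> (\<kappa> * (B / Y)) powr \<alpha>" if "D w \<le> Y powr - \<alpha>" "0 < Y" for w Y
  proof -
    have "D w * t \<le> Y powr - \<alpha> * t" using that tpos by simp
    also have "\<dots> = (t powr (1 / \<alpha>) / Y) powr \<alpha>"
      using that tpos \<alpha> by (simp add: powr_divide powr_powr powr_minus field_simps)
    finally show ?thesis by (simp add: \<kappa>B[symmetric])
  qed
  \<comment> \<open>The smallest weights dominate because only quantities at most \<open>1\<close> are raised to them.\<close>
  define E where "E w k = (case k of Inl j \<Rightarrow> (D w * t) powr s | Inr i \<Rightarrow> (T w / B) powr r)"
    for w :: "int ^ ('m + 'n)" and k :: "'m + 'n"
  have coord: "\<bar>(dual_matrix \<Theta> *v real_vec w) $ k\<bar> * box_side \<sigma> \<rho> \<gamma> t k \<le> E w k"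
    if "D w * t \<le> 1" "T w / B \<le> 1" for w k
  proof (cases k)
    case (Inl j)
    have "\<bar>(dual_matrix \<Theta> *v real_vec w) $ Inl j\<bar> \<le> D w powr (\<sigma> $ j)"
      using abs_le_weighted_norm[OF weights_bounds(1)[OF w(1)] order_refl, of "left_part (dual_matrix \<Theta> *v real_vec w)" j]
      by (simp add: D_def dual_dist_def)
    then have "\<bar>(dual_matrix \<Theta> *v real_vec w) $ k\<bar> * box_side \<sigma> \<rho> \<gamma> t k \<le> D w powr (\<sigma> $ j) * t powr (\<sigma> $ j)"
      by (simp add: Inl box_side_def mult_right_mono)
    also have "\<dots> = (D w * t) powr (\<sigma> $ j)" using D0 tpos by (simp add: powr_mult)
    also have "\<dots> \<le> (D w * t) powr s" using that s D0[of w] tpos by (intro powr_mono') auto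
    finally show ?thesis by (simp add: E_def Inl)
  next
    case (Inr i)
    have "\<bar>(dual_matrix \<Theta> *v real_vec w) $ Inr i\<bar> \<le> T w powr (\<rho> $ i)"
      using abs_le_weighted_norm[OF weights_bounds(1)[OF w(2)], of "right_part (real_vec w)" "T w" i]
      by (simp add: T_def dual_height_def dual_matrix_mult)
    then have "\<bar>(dual_matrix \<Theta> *v real_vec w) $ k\<bar> * box_side \<sigma> \<rho> \<gamma> t k \<le> T w powr (\<rho> $ i) * t powr (- \<gamma> * \<rho> $ i)"
      by (simp add: Inr box_side_def mult_right_mono)
    also have "t powr (- \<gamma> * \<rho> $ i) = 1 / B powr (\<rho> $ i)"
      by (simp add: B_def powr_powr powr_minus_divide)
    also have "T w powr (\<rho> $ i) * (1 / B powr (\<rho> $ i)) = (T w / B) powr (\<rho> $ i)"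
      using Tpos[of w] B by (simp add: powr_divide)
    also have "\<dots> \<le> (T w / B) powr r" using that r Tpos[of w] B by (intro powr_mono') auto
    finally show ?thesis by (simp add: E_def Inr)
  qed
  have side: "0 < box_side \<sigma> \<rho> \<gamma> t k" for k using tpos by (rule box_side_pos)
  have single: ?goal if v: "v \<noteq> 0" "T v \<le> \<kappa> * B" "D v \<le> B powr - \<alpha>" for v
  proof -
    have x: "T v / B \<le> \<kappa>" using v(2) B by (simp add: field_simps)
    have d: "D v * t \<le> \<kappa> powr \<alpha>" using dist[OF v(3) B] B by simp
    have "\<kappa> powr \<alpha> \<le> 1" using \<kappa> \<kappa>1 \<alpha> by (intro powr_le1) auto
    have "E v k \<le> N" for k
    proof (cases k)
      case (Inl j)
      have "(D v * t) powr s \<le> (\<kappa> powr \<alpha>) powr s" using d D0[of v] tpos s by (intro powr_mono2) auto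
      then show ?thesis using \<kappa>s by (simp add: E_def Inl powr_powr)
    next
      case (Inr i)
      have "(T v / B) powr r \<le> \<kappa> powr r" using x Tpos[of v] B r by (intro powr_mono2) auto
      then show ?thesis using \<kappa>r by (simp add: E_def Inr)
    qed
    then have "\<bar>(dual_matrix \<Theta> *v real_vec v) $ k\<bar> * box_side \<sigma> \<rho> \<gamma> t k \<le> N" for k
      using coord[of v k] d \<open>\<kappa> powr \<alpha> \<le> 1\<close> x \<kappa>1 by (meson order_trans)
    then show ?goal
      using lattice_point_in_box_1[OF primal_dual_matrix[of \<Theta>], where a="box_side \<sigma> \<rho> \<gamma> t" and w = v] card side v(1)
      by (simp add: det_dual_matrix N)
  qed
  obtain u R where u: "u \<in> {w. w \<noteq> 0}" and R: "T u \<le> R" "K \<le> T u * R" "D u \<le> R powr - \<alpha>"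
    and alt: "T u = T0 \<or> (\<exists>p\<in>{w. w \<noteq> 0}. T p < T u \<and> D u < D p \<and> T p * T u \<le> K \<and> D p \<le> T u powr - \<alpha>)"
  proof (rule consecutive_minimal_points[of "{w. w \<noteq> 0}" T D T0 \<alpha> K])
    show "finite {v \<in> {w. w \<noteq> 0}. T v \<le> R \<and> D v \<le> d}" for R d
      by (rule finite_subset[OF _ finite_dual_points[OF w, of R \<Theta> d]]) (auto simp: T_def D_def)
    show "\<exists>v\<in>{w. w \<noteq> 0}. T v \<le> R \<and> D v \<le> R powr - \<alpha>" if "T0 \<le> R" for R
      using dual[OF that] that by (auto simp: T_def D_def)
    have "T0 * T0 \<le> t powr \<gamma> * t powr (1 / \<alpha>)" using t T0 by (intro mult_mono) auto
    then show "T0\<^sup>2 \<le> K" by (simp add: K_def powr_add power2_eq_square)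
  qed (use T0 \<alpha> in \<open>auto simp: T_def\<close>)
  show ?goal
  proof (cases "T u \<le> \<kappa> * B")
    case True
    have "\<kappa> * B * B \<le> T u * R" using R by (simp add: \<kappa>BB)
    also have "\<dots> \<le> \<kappa> * B * R" using True R(1) Tpos[of u] by (intro mult_right_mono) auto
    finally have "B \<le> R" using \<kappa> B by simp
    then have "R powr - \<alpha> \<le> B powr - \<alpha>" using B \<alpha> by (intro powr_mono2') auto
    then show ?thesis using single[of u] u True R(3) by auto
  next
    case False
    then have "T u \<noteq> T0" using t(2) by (auto simp: \<kappa>B)
    then obtain p where p: "p \<noteq> 0" "T p < T u" "D u < D p" "T p * T u \<le> K" "D p \<le> T u powr - \<alpha>"
      using alt by auto
    show ?thesis
    proof (cases "T u < B")
      case ge: False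
      have "T p * B \<le> T p * T u" using ge Tpos[of p] by (intro mult_left_mono) auto
      also have "\<dots> \<le> \<kappa> * B * B" using p(4) by (simp add: \<kappa>BB)
      finally have "T p \<le> \<kappa> * B" using B by simp
      moreover have "T u powr - \<alpha> \<le> B powr - \<alpha>" using ge B \<alpha> by (intro powr_mono2') auto
      ultimately show ?thesis using single[of p] p by auto
    next
      case less: True
      define x y \<delta> \<delta>' where "x = T p / B" and "y = T u / B" and "\<delta> = D p * t" and "\<delta>' = D u * t"
      have "0 < R" using R(1) Tpos[of u] by linarith
      have x: "0 < x" "x \<le> y" "x * y \<le> \<kappa>" "\<kappa> < y" "y < 1"
        using Tpos[of p] p(2,4) less False B
        by (auto simp: x_def y_def field_simps \<kappa>BB[symmetric])
      have d1: "\<delta> \<le> (\<kappa> / y) powr \<alpha>" using dist[OF p(5) Tpos] by (simp add: \<delta>_def y_def)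
      have "\<kappa> * (B / R) \<le> y"
        using R(2) \<open>0 < R\<close> B by (simp add: y_def field_simps \<kappa>BB[symmetric])
      then have "(\<kappa> * (B / R)) powr \<alpha> \<le> y powr \<alpha>" using \<kappa> B \<open>0 < R\<close> \<alpha> by (intro powr_mono2) auto
      then have d2: "\<delta>' \<le> y powr \<alpha>" using dist[OF R(3) \<open>0 < R\<close>] by (simp add: \<delta>'_def)
      have d3: "0 \<le> \<delta>'" "\<delta>' \<le> \<delta>" using D0[of u] p(3) tpos by (auto simp: \<delta>_def \<delta>'_def)
      note ineq = two_point_inequalities[OF r(1) s(1) \<alpha> \<kappa> \<kappa>r \<kappa>s x d3 d1 d2]
      have E: "E p k * E u l \<le> N" for k l
        using ineq by (cases k; cases l) (simp_all add: E_def x_def y_def \<delta>_def \<delta>'_def mult.commute)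
      have cp: "\<bar>(dual_matrix \<Theta> *v real_vec p) $ k\<bar> * box_side \<sigma> \<rho> \<gamma> t k \<le> E p k" for k
        using coord[of p k] ineq(1) x by (simp add: \<delta>_def x_def)
      have cu: "\<bar>(dual_matrix \<Theta> *v real_vec u) $ k\<bar> * box_side \<sigma> \<rho> \<gamma> t k \<le> E u k" for k
        using coord[of u k] ineq(1) d3 x by (simp add: \<delta>'_def y_def)
      have E0: "0 \<le> E v k" for v k by (simp add: E_def split: sum.split)
      have "dual_height \<rho> p < dual_height \<rho> u" using p(2) by (auto simp: T_def)
      then have "real_vec p \<noteq> c *\<^sub>R real_vec u" for c
        by (rule dual_points_not_proportional[OF weights_bounds(1)[OF w(1)] weights_bounds(1)[OF w(2)]])
          (use p(3) in \<open>simp add: D_def\<close>)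
      moreover have "(\<bar>(dual_matrix \<Theta> *v real_vec p) $ k\<bar> * box_side \<sigma> \<rho> \<gamma> t k) *
          (\<bar>(dual_matrix \<Theta> *v real_vec u) $ l\<bar> * box_side \<sigma> \<rho> \<gamma> t l) \<le> N" for k l
        using mult_mono[OF cp[of k] cu[of l]] E[of k l] E0 side[of l] by (meson abs_ge_zero less_imp_le mult_nonneg_nonneg order_trans)
      ultimately show ?thesis
        using lattice_point_in_box_2[OF primal_dual_matrix[of \<Theta>], where a="box_side \<sigma> \<rho> \<gamma> t" and p = p and u = u] card side u
        by (simp add: det_dual_matrix N)
    qed
  qed
qed

lemma uniform_transference:
  fixes \<Theta> :: "real ^ 'm::{finite,wellorder} ^ 'n::{finite,wellorder}"
  assumes w: "weights \<sigma>" "weights \<rho>" and card: "3 \<le> CARD('m + 'n)"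
    and \<gamma>: "1 \<le> \<gamma>" and \<alpha>: "0 < \<alpha>"
    and h1: "\<gamma> - 1 \<le> last_weight \<rho> * (\<gamma> - 1 / \<alpha>)"
    and h2: "\<gamma> - 1 \<le> last_weight \<sigma> * (\<alpha> * \<gamma> - 1)"
    and dual: "\<forall>\<^sub>F R in at_top. \<exists>w :: int ^ ('m + 'n). w \<noteq> 0 \<and> dual_height \<rho> w \<le> R \<and> dual_dist \<sigma> \<Theta> w \<le> R powr - \<alpha>"
  shows "ereal \<gamma> \<le> uniform_exponent \<sigma> \<rho> \<Theta>"
proof (rule uniform_exponent_ge[OF w box_const_ge_1])
  obtain T1 where "\<And>R. T1 \<le> R \<Longrightarrow> \<exists>w :: int ^ ('m + 'n). w \<noteq> 0 \<and> dual_height \<rho> w \<le> R \<and> dual_dist \<sigma> \<Theta> w \<le> R powr - \<alpha>"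
    using dual unfolding eventually_at_top_linorder by blast
  moreover define T0 where "T0 = max 1 T1"
  ultimately have T0: "0 < T0"
    "\<And>R. T0 \<le> R \<Longrightarrow> \<exists>w :: int ^ ('m + 'n). w \<noteq> 0 \<and> dual_height \<rho> w \<le> R \<and> dual_dist \<sigma> \<Theta> w \<le> R powr - \<alpha>"
    by auto
  have ev: "\<forall>\<^sub>F t in at_top. T0 \<le> t powr e" if "0 < e" for e :: real
  proof -
    have "filterlim (\<lambda>t::real. t powr e) at_top at_top" using that by real_asymp
    then show ?thesis by (simp add: filterlim_at_top)
  qed
  have "0 < 1 / \<alpha>" "0 < \<gamma>" using \<alpha> \<gamma> by auto
  from eventually_ge_at_top[of 1] ev[OF this(1)] ev[OF this(2)]
  show "\<forall>\<^sub>F t in at_top. \<exists>z :: int ^ ('m + 'n). z \<noteq> 0 \<and>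
      (\<forall>k. \<bar>(primal_matrix \<Theta> *v real_vec z) $ k\<bar> \<le> box_const CARD('m + 'n) * box_side \<sigma> \<rho> \<gamma> t k)"
    by eventually_elim (rule uniform_transference_at[OF w card \<gamma> \<alpha> h1 h2 T0])
qed

section \<open>The inhomogeneous system\<close>

text \<open>
  If the dual system with exponent \<open>1 / \<gamma>\<close> is unsolvable for arbitrarily large bounds, then for
  these bounds the covering property of the primal lattice solves the inhomogeneous system with
  every exponent smaller than \<open>\<gamma>\<close>, for every \<open>\<eta>\<close>.
\<close>

lemma inhomogeneous_exponent_ge:
  fixes \<Theta> :: "real ^ 'm::{finite,wellorder} ^ 'n::{finite,wellorder}"
  assumes w: "weights \<sigma>" "weights \<rho>" and \<gamma>: "0 < \<gamma>"
    and nodual: "\<not> (\<forall>\<^sub>F R in at_top. \<exists>w :: int ^ ('m + 'n). w \<noteq> 0 \<and>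
      dual_height \<rho> w \<le> R \<and> dual_dist \<sigma> \<Theta> w \<le> R powr - (1 / \<gamma>))"
  shows "ereal \<gamma> \<le> inhomogeneous_exponent \<sigma> \<rho> \<Theta> \<eta>"
proof (rule ereal_le_if_reals_le)
  fix \<gamma>' assume less: "\<gamma>' < \<gamma>"
  note s = weights_bounds[OF w(1)] and r = weights_bounds[OF w(2)]
  define \<alpha> where "\<alpha> = 1 / \<gamma>"
  have \<alpha>: "0 < \<alpha>" "\<alpha> * \<gamma>' < 1" using \<gamma> less by (auto simp: \<alpha>_def field_simps)
  define C :: real where "C = 2 ^ CARD('m + 'n)"
  have C: "1 \<le> C" by (simp add: C_def)
  define c1 where "c1 = (3 * C) powr (1 / last_weight \<sigma>)"
  define c2 where "c2 = C powr (1 / last_weight \<rho>)"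
  have c12: "0 < c1" "0 < c2" using C by (auto simp: c1_def c2_def)
  have "\<exists>t\<ge>T. \<exists>(x :: int ^ 'm::_) (y :: int ^ 'n::_). (x, y) \<noteq> (0, 0) \<and>
       weighted_norm \<sigma> (real_vec x) \<le> t \<and> weighted_norm \<rho> (\<Theta> *v real_vec x - real_vec y - \<eta>) \<le> t powr (- \<gamma>')" for T
  proof -
    have "filterlim (\<lambda>R::real. c1 * R powr \<alpha>) at_top at_top" using \<alpha>(1) c12(1) by real_asymp
    then have ev1: "\<forall>\<^sub>F R in at_top. T \<le> c1 * R powr \<alpha>" by (simp add: filterlim_at_top)
    have "filterlim (\<lambda>R::real. R powr (1 - \<alpha> * \<gamma>')) at_top at_top" using \<alpha>(2) by real_asymp
    then have ev2: "\<forall>\<^sub>F R in at_top. c2 * c1 powr \<gamma>' \<le> R powr (1 - \<alpha> * \<gamma>')" by (simp add: filterlim_at_top)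
    have "\<exists>\<^sub>F R in at_top. (\<nexists>w :: int ^ ('m + 'n). w \<noteq> 0 \<and>
        dual_height \<rho> w \<le> R \<and> dual_dist \<sigma> \<Theta> w \<le> R powr - \<alpha>) \<and>
        T \<le> c1 * R powr \<alpha> \<and> c2 * c1 powr \<gamma>' \<le> R powr (1 - \<alpha> * \<gamma>') \<and> 0 < R"
      using nodual eventually_conj[OF ev1 eventually_conj[OF ev2 eventually_gt_at_top[of 0]]]
      unfolding not_eventually \<alpha>_def by (rule frequently_eventually_frequently)
    from frequently_ex[OF this] obtain R where R: "\<And>w :: int ^ ('m + 'n). w \<noteq> 0 \<Longrightarrow> \<not> (dual_height \<rho> w \<le> R \<and> dual_dist \<sigma> \<Theta> w \<le> R powr - \<alpha>)"
        "T \<le> c1 * R powr \<alpha>" "c2 * c1 powr \<gamma>' \<le> R powr (1 - \<alpha> * \<gamma>')" "0 < R"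
      by auto
    define t where "t = c1 * R powr \<alpha>"
    have t: "0 < t" using c12 R by (simp add: t_def)
    define b where "b k = (case k of Inl j \<Rightarrow> R powr (- \<alpha> * \<sigma> $ j) | Inr i \<Rightarrow> R powr (\<rho> $ i))" for k :: "'m + 'n"
    have b: "0 < b k" for k using R by (auto simp: b_def split: sum.split)
    \<comment> \<open>The first block of the target is twice as far from the origin as the covering radius,
        which forces the solution to be nonzero even if \<open>\<eta>\<close> is an integer vector.\<close>
    define x :: "real ^ ('m + 'n)" where "x = (\<chi> k. case k of Inl j \<Rightarrow> 2 * C / b k | Inr i \<Rightarrow> - \<eta> $ i)"
    have "\<exists>z :: int ^ ('m + 'n). \<forall>k. \<bar>(primal_matrix \<Theta> *v real_vec z) $ k - x $ k\<bar> \<le> 2 ^ CARD('m + 'n) / b k"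
    proof (rule lattice_covering[OF primal_dual_matrix b])
      fix w :: "int ^ ('m + 'n)" assume w0: "w \<noteq> 0"
      show "\<exists>k. b k < \<bar>(dual_matrix \<Theta> *v real_vec w) $ k\<bar>"
      proof (rule ccontr)
        assume "\<not> ?thesis"
        then have le: "\<bar>(dual_matrix \<Theta> *v real_vec w) $ k\<bar> \<le> b k" for k by (meson not_le)
        have "dual_height \<rho> w \<le> R"
          unfolding dual_height_def using le[of "Inr _"] r(1) R
          by (subst weighted_norm_le_iff) (auto simp: b_def dual_matrix_mult)
        moreover have "dual_dist \<sigma> \<Theta> w \<le> R powr - \<alpha>"
          unfolding dual_dist_def using le[of "Inl _"] s(1) R
          by (subst weighted_norm_le_iff) (auto simp: b_def powr_powr)
        ultimately show False using R(1)[OF w0] by blast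
      qed
    qed
    then obtain z :: "int ^ ('m + 'n)" where
      z: "\<And>k. \<bar>(primal_matrix \<Theta> *v real_vec z) $ k - x $ k\<bar> \<le> C / b k" by (auto simp: C_def)
    have zl: "\<bar>real_of_int (z $ Inl j) - 2 * (C / b (Inl j))\<bar> \<le> C / b (Inl j)" for j
      using z[of "Inl j"] by (simp add: primal_matrix_mult x_def)
    have "z \<noteq> 0"
    proof
      fix j assume "z = 0"
      then show False using zl[of j] b[of "Inl j"] C by (auto simp: field_simps)
    qed
    moreover have "\<bar>real_vec (left_part z) $ j\<bar> \<le> t powr (\<sigma> $ j)" for j
    proof -
      have "\<bar>real_vec (left_part z) $ j\<bar> \<le> 3 * (C / b (Inl j))" using zl[of j] by simp
      also have "\<dots> = (3 * C) * (R powr \<alpha>) powr (\<sigma> $ j)"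
        using R by (simp add: b_def powr_powr powr_minus field_simps)
      also have "\<dots> \<le> c1 powr (\<sigma> $ j) * (R powr \<alpha>) powr (\<sigma> $ j)"
        unfolding c1_def using s C by (intro mult_right_mono le_powr_inverse_powr) auto
      also have "\<dots> = t powr (\<sigma> $ j)" using c12 by (simp add: t_def powr_mult)
      finally show ?thesis .
    qed
    moreover have "\<bar>(\<Theta> *v real_vec (left_part z) - real_vec (right_part z) - \<eta>) $ i\<bar> \<le> (t powr - \<gamma>') powr (\<rho> $ i)" for i
    proof -
      have "c2 / R = c2 * c1 powr \<gamma>' * (c1 powr - \<gamma>' / R)" using c12 by (simp add: powr_minus field_simps)
      also have "\<dots> \<le> R powr (1 - \<alpha> * \<gamma>') * (c1 powr - \<gamma>' / R)"
        using R by (intro mult_right_mono) auto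
      also have "\<dots> = t powr - \<gamma>'"
        using R c12 by (simp add: t_def powr_mult powr_powr powr_diff powr_minus field_simps)
      finally have le: "c2 / R \<le> t powr - \<gamma>'" .
      have "\<bar>(\<Theta> *v real_vec (left_part z) - real_vec (right_part z) - \<eta>) $ i\<bar> \<le> C / b (Inr i)"
        using z[of "Inr i"] by (simp add: primal_matrix_mult x_def)
      also have "\<dots> \<le> c2 powr (\<rho> $ i) / b (Inr i)"
        unfolding c2_def using r C b[of "Inr i"] by (intro divide_right_mono le_powr_inverse_powr) (auto intro: less_imp_le)
      also have "\<dots> = (c2 / R) powr (\<rho> $ i)" using c12 R by (simp add: b_def powr_divide)
      also have "\<dots> \<le> (t powr - \<gamma>') powr (\<rho> $ i)"
        using le r c12 R by (intro powr_mono2) (auto intro: less_imp_le)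
      finally show ?thesis .
    qed
    ultimately have "z \<noteq> 0" "weighted_norm \<sigma> (real_vec (left_part z)) \<le> t"
      "weighted_norm \<rho> (\<Theta> *v real_vec (left_part z) - real_vec (right_part z) - \<eta>) \<le> t powr - \<gamma>'"
      using t s(1) r(1) by (simp_all add: weighted_norm_le_iff del: part_real_vec vector_minus_component)
    then show ?thesis using R(2) parts_eq_0[of z] unfolding t_def by blast
  qed
  then show "ereal \<gamma>' \<le> inhomogeneous_exponent \<sigma> \<rho> \<Theta> \<eta>"
    unfolding inhomogeneous_exponent_def by (intro Sup_upper) blast
qed

text \<open>
  The two upper bounds on \<open>\<gamma>\<close> are strict, so the hypotheses of the transference theorem with
  \<open>\<alpha> = 1 / \<gamma>\<close> persist for an exponent slightly larger than \<open>\<omega>\<close>. Hence the dual system with this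
  \<open>\<alpha>\<close> cannot be solvable for all large bounds.
\<close>

lemma inhomogeneous_exponent_ge_uniform:
  fixes \<Theta> :: "real ^ 'm::{finite,wellorder} ^ 'n::{finite,wellorder}"
  assumes w: "weights \<sigma>" "weights \<rho>" and card: "3 \<le> CARD('m + 'n)"
    and \<omega>: "uniform_exponent \<sigma> \<rho> \<Theta> = ereal \<omega>" "1 \<le> \<omega>"
    and sr: "s = last_weight \<sigma>" "r = last_weight \<rho>"
    and \<gamma>: "0 < \<gamma>" "r * \<gamma> < 1 - (1 - r) * \<omega>" "\<gamma> * (\<omega> - 1 + s) < s * \<omega>"
  shows "ereal \<gamma> \<le> inhomogeneous_exponent \<sigma> \<rho> \<Theta> \<eta>"
proof (rule inhomogeneous_exponent_ge[OF w \<gamma>(1)], rule notI)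
  assume dual: "\<forall>\<^sub>F R in at_top. \<exists>w :: int ^ ('m + 'n). w \<noteq> 0 \<and>
      dual_height \<rho> w \<le> R \<and> dual_dist \<sigma> \<Theta> w \<le> R powr - (1 / \<gamma>)"
  define e where "e = min (1 - (1 - r) * \<omega> - r * \<gamma>) ((s * \<omega> - \<gamma> * (\<omega> - 1 + s)) / \<gamma>)"
  have r: "0 < r" and s: "0 < s" using weights_bounds(2)[OF w(1)] weights_bounds(2)[OF w(2)] by (auto simp: sr)
  have e: "0 < e" using \<gamma> by (simp add: e_def)
  have "r * e \<ge> 0" using r e by simp
  moreover have "e \<le> 1 - (1 - r) * \<omega> - r * \<gamma>" by (simp add: e_def)
  ultimately have h1: "\<omega> + e - 1 \<le> r * (\<omega> + e - \<gamma>)" by (simp add: algebra_simps)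
  have "e \<le> (s * \<omega> - \<gamma> * (\<omega> - 1 + s)) / \<gamma>" by (simp add: e_def)
  then have "e * \<gamma> \<le> s * \<omega> - \<gamma> * (\<omega> - 1 + s)" using \<gamma>(1) by (simp add: pos_le_divide_eq)
  moreover have "s * e \<ge> 0" using s e by simp
  ultimately have "\<gamma> * (\<omega> + e - 1) \<le> s * (\<omega> + e - \<gamma>)" by (simp add: algebra_simps)
  then have "\<omega> + e - 1 \<le> s * (\<omega> + e - \<gamma>) / \<gamma>" using \<gamma>(1) by (simp add: pos_le_divide_eq mult.commute)
  also have "\<dots> = s * (1 / \<gamma> * (\<omega> + e) - 1)" using \<gamma>(1) by (simp add: field_simps)
  finally have h2: "\<omega> + e - 1 \<le> s * (1 / \<gamma> * (\<omega> + e) - 1)" .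
  have "ereal (\<omega> + e) \<le> uniform_exponent \<sigma> \<rho> \<Theta>"
    by (rule uniform_transference[OF w card _ _ _ _ dual]) (use h1 h2 \<gamma> \<omega>(2) e in \<open>auto simp: sr\<close>)
  then show False using \<omega> e by simp
qed

lemma last_weight_less_1:
  fixes w :: "real ^ 'k::{finite,wellorder}"
  assumes "weights w" "2 \<le> CARD('k)"
  shows "last_weight w < 1"
proof -
  have "UNIV \<noteq> {Max UNIV :: 'k}"
    using assms(2) by (metis One_nat_def Suc_1 card.empty card.insert empty_iff finite.emptyI not_less_eq_eq order_refl)
  then obtain i :: 'k where i: "i \<noteq> Max UNIV" by blast
  have "(\<Sum>k\<in>{i, Max UNIV}. w $ k) \<le> (\<Sum>k\<in>UNIV. w $ k)"
    using weights_bounds(1)[OF assms(1)] by (intro sum_mono2) (auto intro: less_imp_le)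
  then show ?thesis
    using i weights_bounds(1)[OF assms(1), of i] weights_bounds(5)[OF assms(1)] by (simp add: last_weight_def)
qed

theorem theorem6:
  fixes \<Theta> :: "real ^ 'm::{finite,wellorder} ^ 'n::{finite,wellorder}"
    and \<eta> :: "real ^ 'n::_"
    and \<sigma> :: "real ^ 'm::_" and \<rho> :: "real ^ 'n::_"
    and \<sigma>\<^sub>m \<rho>\<^sub>n \<omega> \<omega>\<^sub>\<eta> :: ereal
  assumes "CARD('m) + CARD('n) \<ge> 3"
    and "weights \<sigma>" and "weights \<rho>"
    and "\<sigma>\<^sub>m = ereal (last_weight \<sigma>)" and "\<rho>\<^sub>n = ereal (last_weight \<rho>)"
    and "\<omega> = uniform_exponent \<sigma> \<rho> \<Theta>"
    and "\<omega>\<^sub>\<eta> = inhomogeneous_exponent \<sigma> \<rho> \<Theta> \<eta>"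
    and "\<omega> < 1 / (1 - \<rho>\<^sub>n)"
  shows "(\<omega> \<ge> (1 - \<sigma>\<^sub>m) / (1 - \<rho>\<^sub>n) \<longrightarrow> \<omega>\<^sub>\<eta> \<ge> (1 - (1 - \<rho>\<^sub>n) * \<omega>) / \<rho>\<^sub>n) \<and>
         (\<omega> \<le> (1 - \<sigma>\<^sub>m) / (1 - \<rho>\<^sub>n) \<longrightarrow> \<omega>\<^sub>\<eta> \<ge> \<sigma>\<^sub>m / (1 - (1 - \<sigma>\<^sub>m) * inverse \<omega>))"
proof -
  note w = assms(2,3)
  define s r where "s = last_weight \<sigma>" and "r = last_weight \<rho>"
  have s: "0 < s" "s \<le> 1" and r: "0 < r" "r \<le> 1"
    using weights_bounds[OF w(1)] weights_bounds[OF w(2)] by (auto simp: s_def r_def)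
  have card: "3 \<le> CARD('m + 'n)" using assms(1) by simp
  have "1 \<le> \<omega>" unfolding assms(6) by (rule uniform_exponent_ge_1[OF w])
  moreover have "\<omega> \<noteq> \<infinity>" using assms(8) by auto
  ultimately obtain v where v: "\<omega> = ereal v" "1 \<le> v" by (cases \<omega>) (auto simp: one_ereal_def)
  have sm: "\<sigma>\<^sub>m = ereal s" and rn: "\<rho>\<^sub>n = ereal r" using assms by (auto simp: s_def r_def)
  \<comment> \<open>For \<open>r = 1\<close> the quotient \<open>(1 - \<sigma>\<^sub>m) / (1 - \<rho>\<^sub>n)\<close> is infinite unless also \<open>s = 1\<close>, which
      happens only if \<open>m = n = 1\<close>.\<close>
  have s1: "s < 1" if "r = 1"
  proof -
    have "CARD('n) < 2" using last_weight_less_1[OF w(2)] that by (force simp: r_def)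
    then show ?thesis using last_weight_less_1[OF w(1)] assms(1) by (simp add: s_def)
  qed
  have vr: "(1 - r) * v < 1"
  proof (cases "r = 1")
    case False
    then have "v < 1 / (1 - r)" using assms(8) by (simp add: v rn one_ereal_def ereal_divide)
    then show ?thesis using False r by (simp add: field_simps)
  qed simp
  have vs: "0 < v - 1 + s" using v s by simp
  define g1 g2 where "g1 = (1 - (1 - r) * v) / r" and "g2 = s * v / (v - 1 + s)"
  have g: "0 < g1" "0 < g2" using vr vs r s v by (auto simp: g1_def g2_def)
  have main: "ereal (min g1 g2) \<le> \<omega>\<^sub>\<eta>"
  proof (rule ereal_le_if_reals_le)
    fix \<gamma> assume \<gamma>: "\<gamma> < min g1 g2"
    define \<gamma>' where "\<gamma>' = max \<gamma> (min g1 g2 / 2)"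
    have \<gamma>': "0 < \<gamma>'" "\<gamma>' < g1" "\<gamma>' < g2" using g \<gamma> by (auto simp: \<gamma>'_def)
    have "ereal \<gamma>' \<le> inhomogeneous_exponent \<sigma> \<rho> \<Theta> \<eta>"
      by (rule inhomogeneous_exponent_ge_uniform[OF w card, of \<Theta> v s r])
        (use \<gamma>' v assms(6) r vs in \<open>auto simp: s_def[symmetric] r_def[symmetric] g1_def g2_def field_simps\<close>)
    moreover have "ereal \<gamma> \<le> ereal \<gamma>'" by (simp add: \<gamma>'_def)
    ultimately show "ereal \<gamma> \<le> \<omega>\<^sub>\<eta>" unfolding assms(7) by (rule order_trans[rotated])
  qed
  \<comment> \<open>The sign of this product decides which of the two bounds is the smaller one.\<close>
  have diff: "s * v * r - (1 - (1 - r) * v) * (v - 1 + s) = ((1 - r) * v - (1 - s)) * (v - 1)"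
    by (simp add: algebra_simps)
  have le12: "g1 \<le> g2" if "1 - s \<le> (1 - r) * v"
  proof -
    have "0 \<le> ((1 - r) * v - (1 - s)) * (v - 1)" using that v by simp
    then have "(1 - (1 - r) * v) * (v - 1 + s) \<le> s * v * r" using diff by linarith
    then show ?thesis using r vs by (simp add: g1_def g2_def frac_le_eq divide_le_0_iff field_simps)
  qed
  have le21: "g2 \<le> g1" if "(1 - r) * v \<le> 1 - s"
  proof -
    have "((1 - r) * v - (1 - s)) * (v - 1) \<le> 0" using that v by (simp add: mult_nonpos_nonneg)
    then have "s * v * r \<le> (1 - (1 - r) * v) * (v - 1 + s)" using diff by linarith
    then show ?thesis using r vs by (simp add: g1_def g2_def field_simps)
  qed
  show ?thesis
  proof (intro conjI impI)
    assume A: "(1 - \<sigma>\<^sub>m) / (1 - \<rho>\<^sub>n) \<le> \<omega>"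
    have "r \<noteq> 1" using A s1 by (auto simp: sm rn v one_ereal_def ereal_divide zero_ereal_def)
    then have "(1 - s) / (1 - r) \<le> v" using A by (simp add: sm rn v one_ereal_def ereal_divide)
    then have "g1 \<le> g2" using \<open>r \<noteq> 1\<close> r by (intro le12) (simp add: field_simps)
    moreover have "(1 - (1 - \<rho>\<^sub>n) * \<omega>) / \<rho>\<^sub>n = ereal g1"
      using r by (simp add: rn v one_ereal_def ereal_divide g1_def)
    ultimately show "(1 - (1 - \<rho>\<^sub>n) * \<omega>) / \<rho>\<^sub>n \<le> \<omega>\<^sub>\<eta>" using main by simp
  next
    assume B: "\<omega> \<le> (1 - \<sigma>\<^sub>m) / (1 - \<rho>\<^sub>n)"
    have "(1 - r) * v \<le> 1 - s"
    proof (cases "r = 1")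
      case False
      then have "v \<le> (1 - s) / (1 - r)" using B by (simp add: sm rn v one_ereal_def ereal_divide)
      then show ?thesis using False r by (simp add: field_simps)
    qed (use s in simp)
    then have "g2 \<le> g1" by (rule le21)
    moreover have "\<sigma>\<^sub>m / (1 - (1 - \<sigma>\<^sub>m) * inverse \<omega>) = ereal g2"
    proof -
      have "1 - (1 - s) * inverse v = (v - 1 + s) / v" using v by (simp add: field_simps)
      then show ?thesis using v vs by (simp add: sm v one_ereal_def ereal_divide g2_def)
    qed
    ultimately show "\<sigma>\<^sub>m / (1 - (1 - \<sigma>\<^sub>m) * inverse \<omega>) \<le> \<omega>\<^sub>\<eta>" using main by simp
  qed
qed

end
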